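(* Let $X\sim\mathrm{VG}(\nu,\alpha,\beta,\mu)$, where $\nu=m+1/2$ for $m=0,1,2,\ldots$, and $0\le|\beta|<\alpha$, $\mu\in\mathbb{R}$. Then, for $r>-1$, if $\mu\ne0$, $$\begin{aligned} \mathbb{E}[|X|^r]&=\frac{(1-\beta^2/\alpha^2)^{m+1}}{2^{m+1}m!\,\alpha^r}\sum_{j=0}^{m}\frac{(m+j)!}{(m-j)!\,j!\,2^j}\bigg[\frac{\mathrm{e}^{-\alpha|\mu|-\beta\mu}\,\Gamma(r+1)}{(1+\mathrm{sgn}(\mu)\beta/\alpha)^{r+m-j+1}}\,U(j-m,\,j-m-r,\,\alpha|\mu|+\beta\mu)\\ &\quad+(\alpha|\mu|)^{r+m-j+1}B(r+1,m-j+1)\,M(m-j+1,\,r+m-j+2,\,-\alpha|\mu|-\beta\mu)\\ &\quad+(\alpha|\mu|)^{r+m-j+1}(m-j)!\;U(m-j+1,\,r+m-j+2,\,\alpha|\mu|-\beta\mu)\bigg], \end{aligned}$$ whilst, for $\mu=0$, $$\mathbb{E}[|X|^r]=\frac{(1-\beta^2/\alpha^2)^{m+1}}{2^{m+1}m!\,\alpha^r}\sum_{j=0}^{m}\frac{(m+j)!}{(m-j)!\,j!\,2^j}\bigg[\frac{\Gamma(r+1)}{(1+\beta/\alpha)^{r+m-j+1}}+\frac{\Gamma(r+1)}{(1-\beta/\alpha)^{r+m-j+1}}\bigg].$$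
   Context: $\mathrm{VG}(\nu,\alpha,\beta,\mu)$ ($\nu>-1/2$, $0\le|\beta|<\alpha$, $\mu\in\mathbb{R}$) denotes the variance-gamma distribution, with probability density function on $\mathbb{R}$ $$p(x)=\frac{(\alpha^2-\beta^2)^{\nu+1/2}}{\sqrt{\pi}(2\alpha)^\nu\Gamma(\nu+1/2)}\,\mathrm{e}^{\beta(x-\mu)}|x-\mu|^\nu K_\nu(\alpha|x-\mu|),$$ where $K_\nu$ is the modified Bessel function of the second kind. $M(a,b,x)={}_1F_1(a;b;x)$ and $U(a,b,x)$ are the confluent hypergeometric functions of the first and second kind (Kummer and Tricomi functions, as in the NIST Handbook, Chapter 13), $B$ is the beta function, and $\mathrm{sgn}$ is the sign function.
   Formalization: For μ=0 the factor Γ(r+1), printed twice, is replaced by Γ(r+m−j+1); the printed formula fails for m≥1 (m=1, β=0, r=2 gives 2/α², whereas the variance is 4/α²). *)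

theory Defs
  imports "HOL-Probability.Probability" "HOL-Library.Landau_Symbols"
begin

text \<open>Modified Bessel function of the second kind, for real order and \<open>x > 0\<close>, by its standard
  integral representation, which is valid for every real order (NIST Handbook, 10.32.9).\<close>

definition bessel_K :: "real \<Rightarrow> real \<Rightarrow> real" where
  "bessel_K \<nu> x = (LBINT t:{0..}. exp (- x * cosh t) * cosh (\<nu> * t))"

definition vg_pdf :: "real \<Rightarrow> real \<Rightarrow> real \<Rightarrow> real \<Rightarrow> real \<Rightarrow> real" where
  "vg_pdf \<nu> \<alpha> \<beta> \<mu> x =
     (\<alpha>\<^sup>2 - \<beta>\<^sup>2) powr (\<nu> + 1/2) / (sqrt pi * (2 * \<alpha>) powr \<nu> * Gamma (\<nu> + 1/2))
     * exp (\<beta> * (x - \<mu>)) * \<bar>x - \<mu>\<bar> powr \<nu> * bessel_K \<nu> (\<alpha> * \<bar>x - \<mu>\<bar>)"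

definition kummer_M :: "real \<Rightarrow> real \<Rightarrow> real \<Rightarrow> real" where
  "kummer_M a b x = (\<Sum>n. pochhammer a n / pochhammer b n * x ^ n / fact n)"

text \<open>Solutions on the positive half-line of Kummer's equation \<open>x w'' + (b - x) w' - a w = 0\<close>.\<close>

definition kummer_solution :: "real \<Rightarrow> real \<Rightarrow> (real \<Rightarrow> real) \<Rightarrow> bool" where
  "kummer_solution a b w \<longleftrightarrow>
     (\<exists>w' w''. \<forall>x>0. (w has_real_derivative w' x) (at x) \<and>
        (w' has_real_derivative w'' x) (at x) \<and>
        x * w'' x + (b - x) * w' x - a * w x = 0)"

text \<open>Tricomi's function for \<open>x > 0\<close>, as in the NIST Handbook (13.2.6): the unique solution of
  Kummer's equation that is asymptotic to \<open>x\<^sup>-\<^sup>a\<close> at infinity. The other solutions have an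
  exponentially growing component, so uniqueness already holds among real solutions on the
  positive half-line. This covers all real \<open>a\<close> and \<open>b\<close>, including non-positive integers.\<close>

definition tricomi_U :: "real \<Rightarrow> real \<Rightarrow> real \<Rightarrow> real" where
  "tricomi_U a b x =
     (THE y. \<exists>w. kummer_solution a b w \<and> w \<sim>[at_top] (\<lambda>t. t powr (- a)) \<and> y = w x)"

end

theory Submission
  imports Defs "HOL-Real_Asymp.Real_Asymp"
begin

text \<open>
  For half-integer order the Bessel function is elementary,
  \<open>K\<^bsub>m+1/2\<^esub>(z) = (\<pi>/(2z))\<^sup>1\<^sup>/\<^sup>2 e\<^sup>-\<^sup>z \<Sum>\<^sub>j c\<^sub>j z\<^sup>-\<^sup>j\<close>, so that, with \<open>y = x - \<mu>\<close>, the density is a linear combination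
  of the functions \<open>|y|\<^sup>k e\<^bsup>\<beta>y - \<alpha>|y|\<^esup>\<close>, \<open>k = m - j\<close>. For \<open>\<mu> > 0\<close>, the integral of \<open>|y + \<mu>|\<^sup>r\<close> against
  such a function splits at \<open>-\<mu>\<close> and \<open>0\<close>. The part over \<open>(0, \<infinity>)\<close> is the Laplace integral of a
  Tricomi function, the part over \<open>(-\<mu>, 0)\<close> is the Euler integral of a Kummer function, and the part over
  \<open>(-\<infinity>, -\<mu>)\<close> is again a Tricomi function, brought into the stated form by
  \<open>U(a - b + 1, 2 - b, x) = x\<^bsup>b-1\<^esup> U(a, b, x)\<close>. The reflection \<open>y \<mapsto> -y\<close> handles \<open>\<mu> < 0\<close>.
\<close>

section \<open>Uniqueness of the Tricomi function\<close>

text \<open>\<open>tricomi_U\<close> is a definite description, so it has no usable value until a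
  solution with the right growth is exhibited and shown to be the only one. For a > 0 the Laplace
  integral is such a solution, and its positivity lets the uniqueness argument run on the whole
  half-line. The first term of the formula has first parameter j - m <= 0, where that integral
  diverges at 0. Multiplying a positive solution by a power of x keeps it positive, so the same
  uniqueness criterion covers this term too. The integrals for \<mu> > 0 are brought to standard
  form by scaling with 1 / \<mu>; at \<mu> = 0 this is impossible, and that case rests on Gamma
  integrals instead.\<close>

lemma kummer_wronskian:
  fixes w1 w2 u1 u2 v1 v2 :: "real \<Rightarrow> real"
  assumes w1: "\<And>x. x > 0 \<Longrightarrow> (w1 has_real_derivative u1 x) (at x)"
    and u1: "\<And>x. x > 0 \<Longrightarrow> (u1 has_real_derivative v1 x) (at x)"
    and e1: "\<And>x. x > 0 \<Longrightarrow> x * v1 x + (b - x) * u1 x - a * w1 x = 0"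
    and w2: "\<And>x. x > 0 \<Longrightarrow> (w2 has_real_derivative u2 x) (at x)"
    and u2: "\<And>x. x > 0 \<Longrightarrow> (u2 has_real_derivative v2 x) (at x)"
    and e2: "\<And>x. x > 0 \<Longrightarrow> x * v2 x + (b - x) * u2 x - a * w2 x = 0"
  obtains C where "\<And>x. x > 0 \<Longrightarrow> w1 x * u2 x - u1 x * w2 x = C * (exp x * x powr (- b))"
proof -
  \<comment> \<open>Abel's identity: eliminating the second derivatives gives x W' = (x - b) W for
    the Wronskian W, and exp(-x) x^b is the integrating factor of this equation.\<close>
  define G where "G x = (w1 x * u2 x - u1 x * w2 x) * (exp (- x) * x powr b)" for x
  have "(G has_real_derivative 0) (at x within {0<..})" if "x > 0" for x
  proof -
    have ode: "x * (w1 x * v2 x - v1 x * w2 x) = (x - b) * (w1 x * u2 x - u1 x * w2 x)"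
      using e1[OF that] e2[OF that] by algebra
    have "(G has_real_derivative
        (u1 x * u2 x + v2 x * w1 x - (v1 x * w2 x + u2 x * u1 x)) * (exp (- x) * x powr b) +
        (exp (- x) * (-1) * x powr b + b * x powr (b - 1) * exp (- x)) * (w1 x * u2 x - u1 x * w2 x)) (at x)"
      unfolding G_def[abs_def]
      using that by (intro DERIV_mult DERIV_diff w1 u1 w2 u2) (auto intro!: derivative_eq_intros)
    moreover have "x powr b = x * x powr (b - 1)"
      using that by (simp add: powr_diff)
    then have "(u1 x * u2 x + v2 x * w1 x - (v1 x * w2 x + u2 x * u1 x)) * (exp (- x) * x powr b) +
        (exp (- x) * (-1) * x powr b + b * x powr (b - 1) * exp (- x)) * (w1 x * u2 x - u1 x * w2 x) =
        exp (- x) * x powr (b - 1) *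
          (x * (w1 x * v2 x - v1 x * w2 x) - (x - b) * (w1 x * u2 x - u1 x * w2 x))"
      by (simp add: algebra_simps)
    ultimately show ?thesis
      using ode by (auto intro: has_field_derivative_at_within)
  qed
  then obtain C where C: "\<And>x. x \<in> {0<..} \<Longrightarrow> G x = C"
    using has_field_derivative_zero_constant[of "{0<..}" G] by auto
  have "w1 x * u2 x - u1 x * w2 x = C * (exp x * x powr (- b))" if "x > 0" for x
  proof -
    have "C * (exp x * x powr (- b)) = (w1 x * u2 x - u1 x * w2 x) * ((exp (- x) * exp x) * (x powr b * x powr (- b)))"
      using C[of x] that by (simp add: G_def)
    then show ?thesis
      using that by (simp add: powr_add[symmetric] exp_add[symmetric])
  qed
  then show ?thesis
    using that by blast
qed

text \<open>Positivity of \<open>w\<close> makes the quotient of another solution by \<open>w\<close> differentiable on the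
  whole half-line. Its derivative is a multiple of \<open>e\<^sup>x x\<^sup>-\<^sup>b w\<^sup>-\<^sup>2\<close>, which is unbounded, so
  the multiple vanishes as soon as the quotient converges.\<close>

lemma kummer_solution_unique:
  assumes w: "kummer_solution a b w" and pos: "\<And>x. x > 0 \<Longrightarrow> w x > 0"
    and w_asymp: "w \<sim>[at_top] (\<lambda>t. t powr (- a))"
    and f: "kummer_solution a b f" and f_asymp: "f \<sim>[at_top] (\<lambda>t. t powr (- a))"
    and x: "x > 0"
  shows "f x = w x"
proof -
  obtain u1 v1 where 1: "\<And>x. x > 0 \<Longrightarrow> (w has_real_derivative u1 x) (at x)"
    "\<And>x. x > 0 \<Longrightarrow> (u1 has_real_derivative v1 x) (at x)"
    "\<And>x. x > 0 \<Longrightarrow> x * v1 x + (b - x) * u1 x - a * w x = 0"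
    using w unfolding kummer_solution_def by auto
  obtain u2 v2 where 2: "\<And>x. x > 0 \<Longrightarrow> (f has_real_derivative u2 x) (at x)"
    "\<And>x. x > 0 \<Longrightarrow> (u2 has_real_derivative v2 x) (at x)"
    "\<And>x. x > 0 \<Longrightarrow> x * v2 x + (b - x) * u2 x - a * f x = 0"
    using f unfolding kummer_solution_def by auto
  obtain C where C: "\<And>x. x > 0 \<Longrightarrow> w x * u2 x - u1 x * f x = C * (exp x * x powr (- b))"
    using kummer_wronskian[OF 1 2] by blast
  define \<rho> where "\<rho> x = f x / w x" for x
  define D where "D x = C * (exp x * x powr (- b)) / (w x)\<^sup>2" for x
  have deriv: "(\<rho> has_real_derivative D x) (at x)" if "x > 0" for x
  proof -
    have "(\<rho> has_real_derivative (u2 x * w x - f x * u1 x) / (w x * w x)) (at x)"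
      unfolding \<rho>_def[abs_def] using that pos[OF that] by (intro DERIV_divide 1 2) auto
    then show ?thesis
      using C[OF that] by (simp add: D_def power2_eq_square mult.commute)
  qed
  have "f \<sim>[at_top] w"
    using f_asymp w_asymp by (metis asymp_equiv_sym asymp_equiv_trans)
  then have "((\<lambda>x. f x / w x) \<longlongrightarrow> 1) at_top"
  proof (rule asymp_equivD_strong)
    show "\<forall>\<^sub>F x in at_top. f x \<noteq> 0 \<or> w x \<noteq> 0"
      using eventually_gt_at_top[of 0] by eventually_elim (use pos in force)
  qed
  then have lim: "(\<rho> \<longlongrightarrow> 1) at_top"
    by (simp add: \<rho>_def[abs_def])
  have "C = 0"
  proof (rule ccontr)
    assume "C \<noteq> 0"
    have "((\<lambda>x. w x / x powr (- a)) \<longlongrightarrow> 1) at_top"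
      using w_asymp
    proof (rule asymp_equivD_strong)
      show "\<forall>\<^sub>F x in at_top. w x \<noteq> 0 \<or> x powr (- a) \<noteq> 0"
        using eventually_gt_at_top[of 0] by eventually_elim simp
    qed
    then have "\<forall>\<^sub>F x in at_top. w x / x powr (- a) < 2"
      by (rule order_tendstoD) simp
    moreover have "filterlim (\<lambda>x::real. exp x * x powr (2 * a - b)) at_top at_top"
      by real_asymp
    \<comment> \<open>The threshold comes from w < 2 x^(-a): then w^2 <= 4 x^(-2a), and 4 / |C| is
      exactly what makes |D| >= 1.\<close>
    then have "\<forall>\<^sub>F x in at_top. exp x * x powr (2 * a - b) \<ge> 4 / \<bar>C\<bar>"
      by (simp add: filterlim_at_top)
    ultimately have "\<forall>\<^sub>F x in at_top. \<bar>D x\<bar> \<ge> 1"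
      using eventually_gt_at_top[of 0]
    proof eventually_elim
      case (elim x)
      have "w x \<le> 2 * x powr (- a)"
        using elim by (simp add: field_simps)
      then have "(w x)\<^sup>2 \<le> (2 * x powr (- a))\<^sup>2"
        using elim pos[of x] by (intro power_mono) auto
      also have "\<dots> = 4 * x powr (- 2 * a)"
        using elim by (simp add: power_mult_distrib powr_power)
      finally have "(w x)\<^sup>2 \<le> 4 * x powr (- 2 * a)" .
      moreover have "4 * x powr (- 2 * a) \<le> \<bar>C\<bar> * (exp x * x powr (2 * a - b)) * x powr (- 2 * a)"
        using elim \<open>C \<noteq> 0\<close> by (intro mult_right_mono) (auto simp: field_simps)
      moreover have "\<bar>C\<bar> * (exp x * x powr (2 * a - b)) * x powr (- 2 * a) = \<bar>C\<bar> * (exp x * x powr (- b))"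
        using elim by (simp add: mult.assoc powr_add[symmetric])
      ultimately have "(w x)\<^sup>2 \<le> \<bar>C\<bar> * (exp x * x powr (- b))"
        by linarith
      then show ?case
        using pos[of x] elim by (simp add: D_def abs_mult field_simps)
    qed
    then obtain N where N: "\<And>x. x \<ge> N \<Longrightarrow> \<bar>D x\<bar> \<ge> 1"
      by (auto simp: eventually_at_top_linorder)
    \<comment> \<open>By the mean value theorem the quotient moves by at least 1 over every unit
      interval far out, whereas convergence forces these increments to 0.\<close>
    have step: "\<bar>\<rho> (x + 1) - \<rho> x\<bar> \<ge> 1" if "x \<ge> max N 1" for x
    proof -
      have "\<exists>z>x. z < x + 1 \<and> \<rho> (x + 1) - \<rho> x = (x + 1 - x) * D z"
        by (rule MVT2) (use deriv that in auto)
      then obtain z where z: "x < z" "\<rho> (x + 1) - \<rho> x = D z"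
        by auto
      then show ?thesis
        using N[of z] that by simp
    qed
    have "((\<lambda>x. \<bar>\<rho> (x + 1) - \<rho> x\<bar>) \<longlongrightarrow> \<bar>1 - 1\<bar>) at_top"
      by (intro tendsto_intros lim filterlim_compose[OF lim]) real_asymp
    then have "\<forall>\<^sub>F x in at_top. \<bar>\<rho> (x + 1) - \<rho> x\<bar> < 1"
      by (rule order_tendstoD) simp
    then have "\<forall>\<^sub>F x::real in at_top. False"
      using eventually_ge_at_top[of "max N 1"] by eventually_elim (use step in force)
    then show False
      by simp
  qed
  then have "(\<rho> has_real_derivative 0) (at x within {0<..})" if "x \<in> {0<..}" for x
    using deriv[of x] that by (auto simp: D_def intro: has_field_derivative_at_within)
  then obtain c where c: "\<And>x. x \<in> {0<..} \<Longrightarrow> \<rho> x = c"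
    using has_field_derivative_zero_constant[of "{0<..}" \<rho>] by auto
  have "((\<lambda>_. c) \<longlongrightarrow> 1) (at_top :: real filter)"
    using lim
  proof (rule Lim_transform_eventually)
    show "\<forall>\<^sub>F x in at_top. \<rho> x = c"
      using eventually_gt_at_top[of 0] by eventually_elim (simp add: c)
  qed
  then have "c = 1"
    by (simp add: tendsto_const_iff)
  then show ?thesis
    using c[of x] x pos[OF x] by (simp add: \<rho>_def)
qed

text \<open>The single gateway to values of \<open>tricomi_U\<close>: any positive solution with the
  right growth identifies the described object.\<close>

lemma tricomi_U_eqI:
  assumes "kummer_solution a b w" "\<And>x. x > 0 \<Longrightarrow> w x > 0" "w \<sim>[at_top] (\<lambda>t. t powr (- a))" "x > 0"
  shows "tricomi_U a b x = w x"
  unfolding tricomi_U_def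
proof (rule the_equality)
  show "\<exists>f. kummer_solution a b f \<and> f \<sim>[at_top] (\<lambda>t. t powr (- a)) \<and> w x = f x"
    using assms by blast
  show "y = w x" if "\<exists>f. kummer_solution a b f \<and> f \<sim>[at_top] (\<lambda>t. t powr (- a)) \<and> y = f x" for y
    using kummer_solution_unique[OF assms(1-3) _ _ assms(4)] that by blast
qed

section \<open>A Laplace-type integral\<close>

text \<open>The common yardstick: it dominates the Laplace and Bessel integrands, sandwiches the
  Laplace integral for large x, and gives the moments at \<mu> = 0.\<close>

lemma has_bochner_integral_Gamma:
  fixes a c :: real
  assumes a: "a > 0" and c: "c > 0"
  shows "has_bochner_integral lborel (\<lambda>t. indicator {0<..} t * (exp (- c * t) * t powr (a - 1)))
           (Gamma a / c powr a)"
proof -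
  have "(\<integral>\<^sup>+t. ennreal (indicator {0..} t * t powr (a - 1) / exp t) \<partial>lborel) = ennreal (Gamma a)"
    using Gamma_conv_nn_integral_real[OF a] by simp
  then have 1: "has_bochner_integral lborel (\<lambda>t. indicator {0..} t * t powr (a - 1) / exp t) (Gamma a)"
    using a by (intro has_bochner_integral_nn_integral) (auto intro!: Gamma_real_nonneg)
  have "has_bochner_integral lborel
      (\<lambda>t. indicator {0..} (0 + c * t) * (0 + c * t) powr (a - 1) / exp (0 + c * t)) (Gamma a /\<^sub>R \<bar>c\<bar>)"
    using 1 c by (subst (asm) lborel_has_bochner_integral_real_affine_iff[where c = c and t = 0]) auto
  then have "has_bochner_integral lborel
      (\<lambda>t. c powr (1 - a) * (indicator {0..} (0 + c * t) * (0 + c * t) powr (a - 1) / exp (0 + c * t)))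
      (c powr (1 - a) * (Gamma a /\<^sub>R \<bar>c\<bar>))"
    by (intro has_bochner_integral_mult_right) auto
  moreover have "c powr (1 - a) * (Gamma a /\<^sub>R \<bar>c\<bar>) = Gamma a / c powr a"
    using c by (simp add: powr_diff field_simps)
  moreover have "c powr (1 - a) * (indicator {0..} (0 + c * t) * (0 + c * t) powr (a - 1) / exp (0 + c * t)) =
      indicator {0<..} t * (exp (- c * t) * t powr (a - 1))" for t
  proof (cases "t > 0")
    case True
    then have "c powr (1 - a) * (c * t) powr (a - 1) = t powr (a - 1)"
      using c by (simp add: powr_mult mult.assoc[symmetric] powr_add[symmetric])
    then show ?thesis
      using True c by (simp add: exp_minus field_simps)
  next
    \<comment> \<open>At t = 0 both sides vanish because \<open>0 powr s = 0\<close>, so the passage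
      from the closed to the open half-line holds pointwise.\<close>
    case False
    then show ?thesis
      using c by (cases "t = 0") (auto simp: indicator_def zero_le_mult_iff)
  qed
  ultimately show ?thesis
    by simp
qed

text \<open>Only limits of the antiderivative enter at the two ends. This suits boundary terms such
  as t^a with a > 0, which need not be differentiable at 0.\<close>

lemma set_integral_FTC_greaterThan:
  fixes f F :: "real \<Rightarrow> real"
  assumes F: "\<And>x. a < x \<Longrightarrow> (F has_real_derivative f x) (at x)"
    and f: "\<And>x. a < x \<Longrightarrow> isCont f x"
    and int: "set_integrable lborel {a<..} f"
    and A: "(F \<longlongrightarrow> A) (at_right a)" and B: "(F \<longlongrightarrow> B) at_top"
  shows "(LBINT x:{a<..}. f x) = B - A"
proof -
  have "(LBINT x=ereal a..\<infinity>. f x) = B - A"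
  proof (rule interval_integral_FTC_integrable)
    show "(F has_vector_derivative f x) (at x)" if "ereal a < ereal x" for x
      using F that by (simp add: has_real_derivative_iff_has_vector_derivative)
    show "set_integrable lborel (einterval (ereal a) \<infinity>) f"
      using int by simp
    show "((F \<circ> real_of_ereal) \<longlongrightarrow> A) (at_right (ereal a))"
      unfolding at_right_ereal using A by (simp add: filterlim_filtermap comp_def)
    show "((F \<circ> real_of_ereal) \<longlongrightarrow> B) (at_left \<infinity>)"
      unfolding at_left_PInf using B by (simp add: filterlim_filtermap comp_def)
  qed (use f in auto)
  then show ?thesis
    by (simp add: interval_integral_to_infinity_eq)
qed

text \<open>From 0 <= ln (1 + t) <= t. In a Laplace integral the factor (1 + t)^q thus shifts the
  variable x by at most |q|, which does not affect the leading order at infinity.\<close>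

lemma powr_one_plus_le_exp:
  fixes t q :: real
  assumes "t \<ge> 0"
  shows "(1 + t) powr q \<le> exp (\<bar>q\<bar> * t)" and "exp (- \<bar>q\<bar> * t) \<le> (1 + t) powr q"
proof -
  have "0 \<le> ln (1 + t)" and le: "ln (1 + t) \<le> t"
    using assms by (auto simp: ln_add_one_self_le_self)
  then have "\<bar>q * ln (1 + t)\<bar> \<le> \<bar>q\<bar> * t"
    by (auto simp: abs_mult intro!: mult_left_mono)
  then have "q * ln (1 + t) \<le> \<bar>q\<bar> * t" "- \<bar>q\<bar> * t \<le> q * ln (1 + t)"
    by linarith+
  then show "(1 + t) powr q \<le> exp (\<bar>q\<bar> * t)" "exp (- \<bar>q\<bar> * t) \<le> (1 + t) powr q"
    using assms by (auto simp: powr_def)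
qed

text \<open>For x <= |q| the rate |q| of the preceding bound is too large to be absorbed by exp(-x
  t). An arbitrarily small rate is bought here at the price of a constant.\<close>

lemma powr_one_plus_le_exp_eps:
  fixes q \<epsilon> :: real
  assumes "\<epsilon> > 0"
  obtains C where "C > 0" "\<And>t. t \<ge> 0 \<Longrightarrow> (1 + t) powr q \<le> C * exp (\<epsilon> * t)"
proof
  \<comment> \<open>The bound \<delta> <= 1 gives 1 + t <= (1 + \<delta> t) / \<delta>, and the
    quotient gives \<delta> |q| <= \<epsilon>; the summand 1 in the denominator covers q =
    0.\<close>
  define \<delta> where "\<delta> = min 1 (\<epsilon> / (\<bar>q\<bar> + 1))"
  have \<delta>: "\<delta> > 0" "\<delta> \<le> 1"
    using assms by (auto simp: \<delta>_def)
  have "\<delta> * \<bar>q\<bar> \<le> \<epsilon> / (\<bar>q\<bar> + 1) * \<bar>q\<bar>"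
    by (intro mult_right_mono) (auto simp: \<delta>_def)
  also have "\<dots> \<le> \<epsilon>"
    using assms by (simp add: field_simps)
  finally have \<delta>q: "\<delta> * \<bar>q\<bar> \<le> \<epsilon>" .
  show "\<delta> powr (- \<bar>q\<bar>) > 0"
    using \<delta> by simp
  show "(1 + t) powr q \<le> \<delta> powr (- \<bar>q\<bar>) * exp (\<epsilon> * t)" if t: "t \<ge> 0" for t
  proof -
    have "\<delta> + \<delta> * t \<le> 1 + \<delta> * t"
      using \<delta> by simp
    then have le: "1 + t \<le> (1 + \<delta> * t) / \<delta>"
      using \<delta> by (simp add: field_simps)
    have "(1 + t) powr q \<le> (1 + t) powr \<bar>q\<bar>"
      using t by (intro powr_mono) auto
    also have "\<dots> \<le> ((1 + \<delta> * t) / \<delta>) powr \<bar>q\<bar>"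
      using t le by (intro powr_mono2) auto
    also have "\<dots> = \<delta> powr (- \<bar>q\<bar>) * (1 + \<delta> * t) powr \<bar>q\<bar>"
      using t \<delta> by (simp add: powr_divide powr_minus field_simps)
    also have "(1 + \<delta> * t) powr \<bar>q\<bar> \<le> exp (\<bar>\<bar>q\<bar>\<bar> * (\<delta> * t))"
      using t \<delta> by (intro powr_one_plus_le_exp) auto
    also have "\<bar>\<bar>q\<bar>\<bar> * (\<delta> * t) \<le> \<epsilon> * t"
      using mult_right_mono[OF \<delta>q t] by (simp add: mult.commute mult.left_commute)
    finally show ?thesis
      by (simp add: mult_left_mono)
  qed
qed

text \<open>The integrand of Gamma(a) U(a, b, x) for p = a - 1 and q = b - a - 1. In these
  parameters differentiation in x raises p by one, up to sign, and leaves q fixed.\<close>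

definition tricomi_integrand :: "real \<Rightarrow> real \<Rightarrow> real \<Rightarrow> real \<Rightarrow> real" where
  "tricomi_integrand p q x t = indicator {0<..} t * (exp (- x * t) * (t powr p * (1 + t) powr q))"

lemma tricomi_integrand_measurable [measurable]: "tricomi_integrand p q x \<in> borel_measurable borel"
  unfolding tricomi_integrand_def[abs_def] by measurable

lemma tricomi_integrand_nonneg: "0 \<le> tricomi_integrand p q x t"
  by (simp add: tricomi_integrand_def)

lemma tricomi_integrand_times: "t * tricomi_integrand p q x t = tricomi_integrand (p + 1) q x t"
  by (auto simp: tricomi_integrand_def indicator_def powr_add)

lemma integrable_tricomi_integrand:
  assumes p: "p > -1" and x: "x > 0"
  shows "integrable lborel (tricomi_integrand p q x)"
proof -
  obtain C where C: "C > 0" "\<And>t. t \<ge> 0 \<Longrightarrow> (1 + t) powr q \<le> C * exp (x / 2 * t)"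
    using powr_one_plus_le_exp_eps[of "x / 2" q] x by auto
  have "integrable lborel (\<lambda>t. indicator {0<..} t * (exp (- (x / 2) * t) * t powr ((p + 1) - 1)))"
    by (rule integrable.intros[OF has_bochner_integral_Gamma]) (use p x in auto)
  then have "integrable lborel (\<lambda>t. C * (indicator {0<..} t * (exp (- (x / 2) * t) * t powr ((p + 1) - 1))))"
    by (rule integrable_mult_right)
  then show ?thesis
  proof (rule Bochner_Integration.integrable_bound)
    have "tricomi_integrand p q x t \<le> C * (indicator {0<..} t * (exp (- (x / 2) * t) * t powr p))" for t
    proof (cases "t > 0")
      case True
      have "exp (- x * t) * (t powr p * (1 + t) powr q) \<le> exp (- x * t) * (t powr p * (C * exp (x / 2 * t)))"
        using True C by (intro mult_left_mono) auto
      also have "\<dots> = C * (exp (- x * t) * exp (x / 2 * t) * t powr p)"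
        by simp
      also have "exp (- x * t) * exp (x / 2 * t) = exp (- (x / 2) * t)"
        by (simp add: exp_add[symmetric])
      finally show ?thesis
        using True by (simp add: tricomi_integrand_def)
    qed (simp add: tricomi_integrand_def)
    then show "AE t in lborel. norm (tricomi_integrand p q x t) \<le>
        norm (C * (indicator {0<..} t * (exp (- (x / 2) * t) * t powr ((p + 1) - 1))))"
      using C by (auto simp: tricomi_integrand_nonneg abs_mult)
  qed simp
qed

definition tricomi_integral :: "real \<Rightarrow> real \<Rightarrow> real \<Rightarrow> real" where
  "tricomi_integral p q x = (\<integral>t. tricomi_integrand p q x t \<partial>lborel)"

text \<open>Taylor's formula for \<open>e\<^sup>-\<^sup>s\<close> bounds the difference quotient, so that no limit has to be
  interchanged with the integral.\<close>

lemma tricomi_integral_deriv: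
  assumes p: "p > -1" and x: "x > 0"
  shows "(tricomi_integral p q has_real_derivative - tricomi_integral (p + 1) q x) (at x)"
proof -
  \<comment> \<open>For |y - x| <= x / 2 the Taylor remainder costs a factor exp(x t / 2) and two
    powers of t. What remains is an integral with rate x / 2 and exponent p + 2, independent of
    y.\<close>
  define K where "K = tricomi_integral (p + 1 + 1) q (x / 2)"
  have expo: "\<bar>exp (- y * t) - exp (- x * t) + (y - x) * (t * exp (- x * t))\<bar>
      \<le> (y - x)\<^sup>2 * (t * (t * exp (- (x / 2) * t)))" if t: "t > 0" and y: "\<bar>y - x\<bar> \<le> x / 2" for y t
  proof -
    define h where "h = (x - y) * t"
    obtain \<xi> where \<xi>: "\<bar>\<xi>\<bar> \<le> \<bar>h\<bar>" and ex: "exp h = (\<Sum>m<2. h ^ m / fact m) + exp \<xi> / fact 2 * h ^ 2"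
      using Maclaurin_exp_le[of h 2] by auto
    have "\<bar>h\<bar> \<le> x / 2 * t"
      using mult_right_mono[OF y, of t] t by (simp add: h_def abs_mult abs_minus_commute)
    then have le: "exp \<xi> \<le> exp (x / 2 * t)"
      using \<xi> by simp
    have "exp (- y * t) = exp (- x * t) * exp h"
      by (simp add: h_def exp_add[symmetric] algebra_simps)
    then have "exp (- y * t) - exp (- x * t) + (y - x) * (t * exp (- x * t)) = exp (- x * t) * (exp h - 1 - h)"
      by (simp add: h_def algebra_simps)
    also have "exp h - 1 - h = exp \<xi> / 2 * h\<^sup>2"
      using ex by (simp add: numeral_2_eq_2)
    also have "\<bar>exp (- x * t) * (exp \<xi> / 2 * h\<^sup>2)\<bar> \<le> exp (- x * t) * (exp (x / 2 * t) * h\<^sup>2)"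
    proof -
      have "exp \<xi> / 2 * h\<^sup>2 \<le> exp (x / 2 * t) * h\<^sup>2"
        using order_trans[of "exp \<xi> / 2" "exp \<xi>", OF _ le] by (intro mult_right_mono) auto
      then show ?thesis
        by (simp add: abs_mult)
    qed
    also have "\<dots> = exp (- x * t) * exp (x / 2 * t) * h\<^sup>2"
      by simp
    also have "exp (- x * t) * exp (x / 2 * t) = exp (- (x / 2) * t)"
      by (simp add: exp_add[symmetric])
    finally show ?thesis
      by (simp add: h_def power_mult_distrib power2_commute[of x y] power2_eq_square[of t] mult_ac)
  qed
  have bound: "\<bar>tricomi_integral p q y - tricomi_integral p q x + (y - x) * tricomi_integral (p + 1) q x\<bar>
      \<le> (y - x)\<^sup>2 * K" if y: "\<bar>y - x\<bar> \<le> x / 2" for y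
  proof -
    have y0: "y > 0"
      using x y by linarith
    have int: "integrable lborel (tricomi_integrand p q z)" "integrable lborel (tricomi_integrand (p + 1) q z)"
        "integrable lborel (tricomi_integrand (p + 1 + 1) q z)" if "z > 0" for z
      using p that by (auto intro!: integrable_tricomi_integrand)
    have eq: "tricomi_integral p q y - tricomi_integral p q x + (y - x) * tricomi_integral (p + 1) q x =
        (\<integral>t. tricomi_integrand p q y t - tricomi_integrand p q x t + (y - x) * tricomi_integrand (p + 1) q x t \<partial>lborel)"
      using int[OF x] int[OF y0] by (simp add: tricomi_integral_def)
    have "\<bar>tricomi_integral p q y - tricomi_integral p q x + (y - x) * tricomi_integral (p + 1) q x\<bar>
        \<le> (\<integral>t. (y - x)\<^sup>2 * tricomi_integrand (p + 1 + 1) q (x / 2) t \<partial>lborel)"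
      unfolding eq
    proof (rule integral_abs_bound_integral)
      fix t :: real
      show "\<bar>tricomi_integrand p q y t - tricomi_integrand p q x t + (y - x) * tricomi_integrand (p + 1) q x t\<bar>
          \<le> (y - x)\<^sup>2 * tricomi_integrand (p + 1 + 1) q (x / 2) t"
      proof (cases "t > 0")
        case True
        define P where "P = t powr p * (1 + t) powr q"
        have P: "P \<ge> 0"
          by (simp add: P_def)
        have "tricomi_integrand p q y t - tricomi_integrand p q x t + (y - x) * tricomi_integrand (p + 1) q x t
          = (exp (- y * t) - exp (- x * t) + (y - x) * (t * exp (- x * t))) * P"
          unfolding tricomi_integrand_times[symmetric]
          using True by (simp add: tricomi_integrand_def P_def algebra_simps)
        also have "\<bar>\<dots>\<bar> = \<bar>exp (- y * t) - exp (- x * t) + (y - x) * (t * exp (- x * t))\<bar> * P"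
          using P by (simp add: abs_mult)
        also have "\<dots> \<le> (y - x)\<^sup>2 * (t * (t * exp (- (x / 2) * t))) * P"
          using expo[OF True y] P by (rule mult_right_mono)
        also have "\<dots> = (y - x)\<^sup>2 * tricomi_integrand (p + 1 + 1) q (x / 2) t"
          unfolding tricomi_integrand_times[symmetric]
          using True by (simp add: tricomi_integrand_def P_def)
        finally show ?thesis .
      qed (simp add: tricomi_integrand_def)
    qed (use int x y0 in auto)
    also have "\<dots> = (y - x)\<^sup>2 * K"
      unfolding K_def tricomi_integral_def by (rule integral_mult_right_zero)
    finally show ?thesis .
  qed
  have "((\<lambda>y. (tricomi_integral p q y - tricomi_integral p q x) / (y - x) - - tricomi_integral (p + 1) q x) \<longlongrightarrow> 0) (at x)"
  proof (rule Lim_null_comparison)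
    have "\<forall>\<^sub>F y in at x. dist y x < x / 2"
      by (rule tendstoD[OF tendsto_ident_at]) (use x in simp)
    then show "\<forall>\<^sub>F y in at x. norm ((tricomi_integral p q y - tricomi_integral p q x) / (y - x) - - tricomi_integral (p + 1) q x)
        \<le> \<bar>y - x\<bar> * K"
      using eventually_neq_at_within[of x x UNIV]
    proof eventually_elim
      case (elim y)
      then have "(tricomi_integral p q y - tricomi_integral p q x) / (y - x) - - tricomi_integral (p + 1) q x
        = (tricomi_integral p q y - tricomi_integral p q x + (y - x) * tricomi_integral (p + 1) q x) / (y - x)"
        by (simp add: field_simps)
      also have "\<bar>\<dots>\<bar> \<le> (y - x)\<^sup>2 * K / \<bar>y - x\<bar>"
        unfolding abs_divide using bound[of y] elim by (intro divide_right_mono) (auto simp: dist_real_def)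
      also have "\<dots> = \<bar>y - x\<bar> * K"
        using elim by (simp add: power2_eq_square abs_if field_simps)
      finally show ?case
        by simp
    qed
    show "((\<lambda>y. \<bar>y - x\<bar> * K) \<longlongrightarrow> 0) (at x)"
      by (auto intro!: tendsto_eq_intros)
  qed
  then show ?thesis
    unfolding has_field_derivative_iff using Lim_null by blast
qed

section \<open>The integral representation of the Tricomi function\<close>

text \<open>Under the integral sign the left-hand side is minus the t-derivative of exp(-x t) t^a (1
  + t)^(b - a), which tends to 0 at 0 since a > 0 and at infinity since x > 0.\<close>

lemma tricomi_integral_ode:
  fixes a b x q :: real
  assumes a: "a > 0" and x: "x > 0"
  defines "q \<equiv> b - a - 1"
  shows "x * tricomi_integral (a + 1) q x + (b - x) * (- tricomi_integral a q x)
           - a * tricomi_integral (a - 1) q x = 0"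
proof -
  define f where "f t = exp (- x * t) * (t powr (a - 1) * (1 + t) powr q) * (a + (b - x) * t - x * t\<^sup>2)" for t
  define F where "F t = exp (- x * t) * (t powr a * (1 + t) powr (b - a))" for t
  have int: "integrable lborel (tricomi_integrand (a - 1) q x)"
      "integrable lborel (tricomi_integrand a q x)" "integrable lborel (tricomi_integrand (a + 1) q x)"
    using a x by (auto intro!: integrable_tricomi_integrand)
  have f_eq: "indicator {0<..} t *\<^sub>R f t = a * tricomi_integrand (a - 1) q x t
      + (b - x) * tricomi_integrand a q x t - x * tricomi_integrand (a + 1) q x t" for t
  proof -
    have "tricomi_integrand a q x t = t * tricomi_integrand (a - 1) q x t"
        "tricomi_integrand (a + 1) q x t = t * (t * tricomi_integrand (a - 1) q x t)"
      by (simp_all add: tricomi_integrand_times)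
    moreover have "indicator {0<..} t *\<^sub>R f t = tricomi_integrand (a - 1) q x t * (a + (b - x) * t - x * t\<^sup>2)"
      by (simp add: f_def tricomi_integrand_def)
    ultimately show ?thesis
      by (simp only:) (simp add: algebra_simps power2_eq_square)
  qed
  have "(LBINT t:{0<..}. f t) = 0 - 0"
  proof (rule set_integral_FTC_greaterThan)
    show "(F has_real_derivative f t) (at t)" if t: "0 < t" for t
    proof -
      have "(F has_real_derivative exp (- x * t) * (- x) * (t powr a * (1 + t) powr (b - a)) +
          (a * t powr (a - 1) * (1 + t) powr (b - a) + (b - a) * (1 + t) powr (b - a - 1) * t powr a) * exp (- x * t)) (at t)"
        unfolding F_def[abs_def] using t
        by (intro DERIV_mult) (auto intro!: derivative_eq_intros)
      moreover have "t powr a = t * t powr (a - 1)" "(1 + t) powr (b - a) = (1 + t) * (1 + t) powr q"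
        using t powr_add[of t "a - 1" 1] powr_add[of "1 + t" q 1] by (simp_all add: q_def)
      ultimately show ?thesis
        by (simp add: f_def q_def algebra_simps power2_eq_square)
    qed
    show "isCont f t" if "0 < t" for t
      unfolding f_def[abs_def] using that by (intro continuous_intros) auto
    show "set_integrable lborel {0<..} f"
      unfolding set_integrable_def f_eq using int by auto
    show "(F \<longlongrightarrow> 0) (at_right 0)"
      unfolding F_def[abs_def] using a by real_asymp
    show "(F \<longlongrightarrow> 0) at_top"
      unfolding F_def[abs_def] using x by real_asymp
  qed
  then have "a * tricomi_integral (a - 1) q x + (b - x) * tricomi_integral a q x
      - x * tricomi_integral (a + 1) q x = 0"
    unfolding set_lebesgue_integral_def f_eq tricomi_integral_def using int by simp
  then show ?thesis
    by (simp add: algebra_simps)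
qed

lemma kummer_solution_tricomi_integral:
  assumes a: "a > 0"
  shows "kummer_solution a b (\<lambda>x. tricomi_integral (a - 1) (b - a - 1) x / c)"
proof -
  let ?T = "\<lambda>p. tricomi_integral p (b - a - 1)"
  have 1: "((\<lambda>x. ?T (a - 1) x / c) has_real_derivative - ?T a x / c) (at x)" if "x > 0" for x
    using tricomi_integral_deriv[of "a - 1" x "b - a - 1"] a that by (intro DERIV_cdivide) auto
  have 2: "((\<lambda>x. - ?T a x / c) has_real_derivative ?T (a + 1) x / c) (at x)" if "x > 0" for x
    using DERIV_cdivide[OF DERIV_minus[OF tricomi_integral_deriv[of a x "b - a - 1"]], of c] a that by auto
  have 3: "x * (?T (a + 1) x / c) + (b - x) * (- ?T a x / c) - a * (?T (a - 1) x / c) = 0" if "x > 0" for x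
  proof -
    have "x * (?T (a + 1) x / c) + (b - x) * (- ?T a x / c) - a * (?T (a - 1) x / c) =
        (x * ?T (a + 1) x + (b - x) * (- ?T a x) - a * ?T (a - 1) x) / c"
      by (simp add: diff_divide_distrib add_divide_distrib)
    then show ?thesis
      using tricomi_integral_ode[OF a that, of b] by simp
  qed
  show ?thesis
    unfolding kummer_solution_def
    using 1 2 3 by (intro exI[of _ "\<lambda>x. - ?T a x / c"] exI[of _ "\<lambda>x. ?T (a + 1) x / c"]) auto
qed

lemma has_bochner_integral_le:
  fixes f g :: "'a \<Rightarrow> real"
  assumes "has_bochner_integral M f A" "has_bochner_integral M g B" "\<And>x. f x \<le> g x"
  shows "A \<le> B"
  using assms integral_mono[of M f g] by (simp add: has_bochner_integral_iff)

text \<open>Bounding (1 + t)^q by exp(|q| t) and exp(-|q| t) leaves Gamma integrals with rates x -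
  |q| and x + |q|. Their ratio tends to 1, which yields the asymptotics; the lower bound also yields
  positivity.\<close>

lemma tricomi_integral_bounds:
  assumes a: "a > 0" and x: "x > 0"
  shows "Gamma a / (x + \<bar>q\<bar>) powr a \<le> tricomi_integral (a - 1) q x"
    and "x > \<bar>q\<bar> \<Longrightarrow> tricomi_integral (a - 1) q x \<le> Gamma a / (x - \<bar>q\<bar>) powr a"
proof -
  have T: "has_bochner_integral lborel (tricomi_integrand (a - 1) q x) (tricomi_integral (a - 1) q x)"
    unfolding tricomi_integral_def using a x
    by (intro has_bochner_integral_integrable integrable_tricomi_integrand) auto
  have *: "exp (- (x + c) * t) * t powr (a - 1) = exp (- x * t) * (t powr (a - 1) * exp (- c * t))" for c t
    by (simp add: exp_add[symmetric] algebra_simps)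
  show "Gamma a / (x + \<bar>q\<bar>) powr a \<le> tricomi_integral (a - 1) q x"
  proof (rule has_bochner_integral_le[OF has_bochner_integral_Gamma T])
    show "indicator {0<..} t * (exp (- (x + \<bar>q\<bar>) * t) * t powr (a - 1)) \<le> tricomi_integrand (a - 1) q x t" for t
      unfolding tricomi_integrand_def *
      using powr_one_plus_le_exp(2)[of t q] by (auto simp: indicator_def intro!: mult_left_mono)
  qed (use a x in auto)
  show "tricomi_integral (a - 1) q x \<le> Gamma a / (x - \<bar>q\<bar>) powr a" if "x > \<bar>q\<bar>"
  proof (rule has_bochner_integral_le[OF T has_bochner_integral_Gamma])
    show "tricomi_integrand (a - 1) q x t \<le> indicator {0<..} t * (exp (- (x - \<bar>q\<bar>) * t) * t powr (a - 1))" for t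
      using powr_one_plus_le_exp(1)[of t q] *[of "- \<bar>q\<bar>" t]
      by (auto simp: tricomi_integrand_def indicator_def intro!: mult_left_mono)
  qed (use a that in auto)
qed

lemma tricomi_integral_pos:
  assumes "a > 0" "x > 0"
  shows "tricomi_integral (a - 1) q x > 0"
proof -
  have "0 < Gamma a / (x + \<bar>q\<bar>) powr a"
    using assms by (auto simp: Gamma_real_pos)
  also have "\<dots> \<le> tricomi_integral (a - 1) q x"
    by (rule tricomi_integral_bounds) fact+
  finally show ?thesis .
qed

lemma tricomi_integral_asymp:
  assumes a: "a > 0"
  shows "(\<lambda>x. tricomi_integral (a - 1) q x / Gamma a) \<sim>[at_top] (\<lambda>x. x powr (- a))"
proof (rule asymp_equivI')
  have G: "Gamma a > 0"
    using a by (rule Gamma_real_pos)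
  show "((\<lambda>x. tricomi_integral (a - 1) q x / Gamma a / x powr (- a)) \<longlongrightarrow> 1) at_top"
  proof (rule tendsto_sandwich)
    show "((\<lambda>x. x powr a / (x + \<bar>q\<bar>) powr a) \<longlongrightarrow> 1) at_top"
      by real_asymp
    show "((\<lambda>x. x powr a / (x - \<bar>q\<bar>) powr a) \<longlongrightarrow> 1) at_top"
      by real_asymp
    show "\<forall>\<^sub>F x in at_top. x powr a / (x + \<bar>q\<bar>) powr a \<le> tricomi_integral (a - 1) q x / Gamma a / x powr (- a)"
      using eventually_gt_at_top[of 0]
    proof eventually_elim
      case (elim x)
      have "Gamma a / (x + \<bar>q\<bar>) powr a * (x powr a / Gamma a) \<le> tricomi_integral (a - 1) q x * (x powr a / Gamma a)"
        using elim a G by (intro mult_right_mono tricomi_integral_bounds) auto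
      moreover have "tricomi_integral (a - 1) q x / Gamma a / x powr (- a) = tricomi_integral (a - 1) q x * (x powr a / Gamma a)"
        by (simp add: powr_minus divide_inverse)
      ultimately show ?case
        using G by simp
    qed
    show "\<forall>\<^sub>F x in at_top. tricomi_integral (a - 1) q x / Gamma a / x powr (- a) \<le> x powr a / (x - \<bar>q\<bar>) powr a"
      using eventually_gt_at_top[of "\<bar>q\<bar>"]
    proof eventually_elim
      case (elim x)
      have "tricomi_integral (a - 1) q x * (x powr a / Gamma a) \<le> Gamma a / (x - \<bar>q\<bar>) powr a * (x powr a / Gamma a)"
        using elim a G by (intro mult_right_mono tricomi_integral_bounds) auto
      moreover have "tricomi_integral (a - 1) q x / Gamma a / x powr (- a) = tricomi_integral (a - 1) q x * (x powr a / Gamma a)"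
        by (simp add: powr_minus divide_inverse)
      ultimately show ?case
        using G by simp
    qed
  qed
qed

theorem tricomi_U_integral_representation:
  assumes a: "a > 0" and x: "x > 0"
  shows "tricomi_U a b x = tricomi_integral (a - 1) (b - a - 1) x / Gamma a"
proof (rule tricomi_U_eqI)
  show "kummer_solution a b (\<lambda>x. tricomi_integral (a - 1) (b - a - 1) x / Gamma a)"
    using a by (rule kummer_solution_tricomi_integral)
  show "(\<lambda>x. tricomi_integral (a - 1) (b - a - 1) x / Gamma a) \<sim>[at_top] (\<lambda>t. t powr (- a))"
    using a by (rule tricomi_integral_asymp)
  show "0 < tricomi_integral (a - 1) (b - a - 1) x / Gamma a" if "x > 0" for x
    using a that by (intro divide_pos_pos tricomi_integral_pos Gamma_real_pos)
qed fact

section \<open>Kummer's equation under multiplication by a power of x\<close>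

lemma kummer_solution_transform:
  assumes "kummer_solution a b f"
  shows "kummer_solution (a - b + 1) (2 - b) (\<lambda>x. x powr (b - 1) * f x)"
proof -
  obtain f' f'' where f: "\<And>x. x > 0 \<Longrightarrow> (f has_real_derivative f' x) (at x)"
    "\<And>x. x > 0 \<Longrightarrow> (f' has_real_derivative f'' x) (at x)"
    "\<And>x. x > 0 \<Longrightarrow> x * f'' x + (b - x) * f' x - a * f x = 0"
    using assms unfolding kummer_solution_def by auto
  define w' where "w' x = (b - 1) * x powr (b - 1 - 1) * f x + f' x * x powr (b - 1)" for x
  define w'' where "w'' x = (b - 1) * ((b - 1 - 1) * x powr (b - 1 - 1 - 1)) * f x + f' x * ((b - 1) * x powr (b - 1 - 1))
      + (f'' x * x powr (b - 1) + (b - 1) * x powr (b - 1 - 1) * f' x)" for x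
  have "((\<lambda>x. x powr (b - 1) * f x) has_real_derivative w' x) (at x)
      \<and> (w' has_real_derivative w'' x) (at x)
      \<and> x * w'' x + (2 - b - x) * w' x - (a - b + 1) * (x powr (b - 1) * f x) = 0" if x: "x > 0" for x
  proof (intro conjI)
    show "((\<lambda>x. x powr (b - 1) * f x) has_real_derivative w' x) (at x)"
      unfolding w'_def using x by (intro DERIV_mult f has_real_derivative_powr)
    show "(w' has_real_derivative w'' x) (at x)"
      unfolding w'_def[abs_def] w''_def using x
      by (intro DERIV_mult DERIV_add DERIV_cmult f has_real_derivative_powr)
         (auto simp: add.commute intro!: DERIV_mult DERIV_cmult f has_real_derivative_powr)
    \<comment> \<open>With every power written as a multiple of the lowest one, x^(b - 3), the
      transformed equation becomes a polynomial identity.\<close>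
    have "x powr (b - 1 - 1) = x * x powr (b - 1 - 1 - 1)" "x powr (b - 1) = x * (x * x powr (b - 1 - 1 - 1))"
      using x by (auto simp: powr_diff power2_eq_square power3_eq_cube)
    then have "x * w'' x + (2 - b - x) * w' x - (a - b + 1) * (x powr (b - 1) * f x) =
        x powr (b - 1) * (x * f'' x + (b - x) * f' x - a * f x)"
      unfolding w'_def w''_def by (simp add: algebra_simps)
    then show "x * w'' x + (2 - b - x) * w' x - (a - b + 1) * (x powr (b - 1) * f x) = 0"
      using f(3)[OF x] by simp
  qed
  then show ?thesis
    unfolding kummer_solution_def by (intro exI[of _ w'] exI[of _ w'']) simp
qed

text \<open>The growth fits because (b - 1) - a = -(a - b + 1), and the factor x^(b - 1) preserves
  positivity, so the uniqueness criterion applies to the product. In this way U becomes accessible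
  at nonpositive first parameters.\<close>

theorem tricomi_U_transform:
  assumes a: "a > 0" and x: "x > 0"
  shows "tricomi_U (a - b + 1) (2 - b) x = x powr (b - 1) * tricomi_U a b x"
proof -
  define f where "f x = tricomi_integral (a - 1) (b - a - 1) x / Gamma a" for x
  have "(\<lambda>x. x powr (b - 1) * f x) \<sim>[at_top] (\<lambda>x. x powr (b - 1) * x powr (- a))"
    using tricomi_integral_asymp[OF a, of "b - a - 1"]
    by (intro asymp_equiv_mult) (auto simp: f_def[abs_def])
  then have "(\<lambda>x. x powr (b - 1) * f x) \<sim>[at_top] (\<lambda>x. x powr (- (a - b + 1)))"
    by (simp add: powr_add[symmetric] algebra_simps)
  moreover have "kummer_solution (a - b + 1) (2 - b) (\<lambda>x. x powr (b - 1) * f x)"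
    unfolding f_def using a by (intro kummer_solution_transform kummer_solution_tricomi_integral)
  moreover have "0 < x powr (b - 1) * f x" if "x > 0" for x
    unfolding f_def using a that
    by (intro mult_pos_pos divide_pos_pos tricomi_integral_pos Gamma_real_pos) auto
  ultimately have "tricomi_U (a - b + 1) (2 - b) x = x powr (b - 1) * f x"
    using x by (intro tricomi_U_eqI)
  then show ?thesis
    using a x by (simp add: f_def tricomi_U_integral_representation)
qed

section \<open>The Euler integral of Kummer's function\<close>

lemma has_bochner_integral_Beta:
  fixes a d :: real
  assumes a: "a > 0" and d: "d > 0"
  shows "has_bochner_integral lborel (\<lambda>t. indicator {0<..<1} t * (t powr (a - 1) * (1 - t) powr (d - 1))) (Beta a d)"
proof -
  have int: "set_integrable lborel {0..1} (\<lambda>t. t powr (a - 1) * (1 - t) powr (d - 1))"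
    using a d by (rule integrable_Beta)
  then have "(LBINT t:{0..1}. t powr (a - 1) * (1 - t) powr (d - 1)) = Beta a d"
    using set_borel_integral_eq_integral(2)[OF int] has_integral_Beta_real[OF a d]
    by (simp add: integral_unique)
  then have "has_bochner_integral lborel (\<lambda>t. indicator {0..1} t * (t powr (a - 1) * (1 - t) powr (d - 1))) (Beta a d)"
    using int by (simp add: has_bochner_integral_iff set_integrable_def set_lebesgue_integral_def)
  moreover have "indicator {0..1} t * (t powr (a - 1) * (1 - t) powr (d - 1)) =
      indicator {0<..<1} t * (t powr (a - 1) * (1 - t) powr (d - 1))" for t
    by (auto simp: indicator_def)
  ultimately show ?thesis
    by simp
qed

lemma Beta_plus_nat:
  fixes a d :: real
  assumes "a > 0" "d > 0"
  shows "Beta (a + real n) d = Beta a d * pochhammer a n / pochhammer (a + d) n"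
proof -
  have "pochhammer a n = Gamma (a + real n) / Gamma a" "pochhammer (a + d) n = Gamma (a + d + real n) / Gamma (a + d)"
    using assms by (auto intro!: pochhammer_Gamma simp: nonpos_Ints_def)
  moreover have "Gamma a > 0" "Gamma (a + d) > 0" "Gamma (a + d + real n) > 0"
    using assms by (auto intro!: Gamma_real_pos add_pos_nonneg)
  ultimately show ?thesis
    by (simp add: Beta_def add_ac)
qed

text \<open>Termwise integration of the exponential series: the n-th term produces Beta(a + n, d),
  whose ratio to Beta(a, d) is the quotient of Pochhammer symbols in the series of M. Since Beta
  decreases in its first argument, the integrals of the absolute values are dominated by Beta(a, d)
  |x|^n / n!, which justifies the interchange.\<close>

lemma has_bochner_integral_kummer_M:
  fixes a d x :: real
  assumes a: "a > 0" and d: "d > 0"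
  shows "has_bochner_integral lborel
      (\<lambda>t. indicator {0<..<1} t * (exp (x * t) * (t powr (a - 1) * (1 - t) powr (d - 1))))
      (Beta a d * kummer_M a (a + d) x)"
proof -
  define g where "g n t = indicator {0<..<1} t * (t powr (a + real n - 1) * (1 - t) powr (d - 1))" for n :: nat and t :: real
  define f where "f n t = x ^ n / fact n * g n t" for n t
  have g: "has_bochner_integral lborel (g n) (Beta (a + real n) d)" for n
    unfolding g_def using a d by (intro has_bochner_integral_Beta) auto
  have f: "has_bochner_integral lborel (f n) (x ^ n / fact n * Beta (a + real n) d)" for n
    unfolding f_def by (intro has_bochner_integral_mult_right g)
  have nf: "has_bochner_integral lborel (\<lambda>t. norm (f n t)) (\<bar>x\<bar> ^ n / fact n * Beta (a + real n) d)" for n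
  proof -
    have "norm (f n t) = \<bar>x\<bar> ^ n / fact n * g n t" for t
      by (simp add: f_def g_def abs_mult power_abs)
    then show ?thesis
      using has_bochner_integral_mult_right[OF g, of "\<bar>x\<bar> ^ n / fact n" n] by (simp only: simp_thms)
  qed
  have sums: "(\<lambda>n. f n t) sums (indicator {0<..<1} t * (exp (x * t) * (t powr (a - 1) * (1 - t) powr (d - 1))))"
    and abs_summable: "summable (\<lambda>n. norm (f n t))" for t
  proof -
    have f_eq: "f n t = (x * t) ^ n /\<^sub>R fact n * (indicator {0<..<1} t * (t powr (a - 1) * (1 - t) powr (d - 1)))" for n
    proof (cases "t \<in> {0<..<1}")
      case True
      then have "t powr (a + real n - 1) = t ^ n * t powr (a - 1)"
        by (simp add: powr_realpow[symmetric] powr_add[symmetric] algebra_simps)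
      then show ?thesis
        using True by (simp add: f_def g_def power_mult_distrib divide_inverse)
    qed (simp add: f_def g_def)
    have "(\<lambda>n. f n t) sums (exp (x * t) * (indicator {0<..<1} t * (t powr (a - 1) * (1 - t) powr (d - 1))))"
      unfolding f_eq by (intro sums_mult2 exp_converges)
    then show "(\<lambda>n. f n t) sums (indicator {0<..<1} t * (exp (x * t) * (t powr (a - 1) * (1 - t) powr (d - 1))))"
      by (simp add: mult.left_commute)
    show "summable (\<lambda>n. norm (f n t))"
      unfolding f_eq norm_mult by (intro summable_mult2 summable_norm_exp)
  qed
  have summable_int: "summable (\<lambda>n. \<integral>t. norm (f n t) \<partial>lborel)"
  proof (rule summable_comparison_test)
    have "summable (\<lambda>n. \<bar>x\<bar> ^ n /\<^sub>R fact n)"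
      by (rule summable_exp_generic)
    then show "summable (\<lambda>n. \<bar>x\<bar> ^ n / fact n * Beta a d)"
      by (intro summable_mult2) (simp add: divide_inverse mult.commute)
    have "Beta (a + real n) d \<ge> 0" for n
      unfolding Beta_def using a d by (intro divide_nonneg_nonneg mult_nonneg_nonneg Gamma_real_nonneg) auto
    then have "norm (\<bar>x\<bar> ^ n / fact n * Beta (a + real n) d) \<le> \<bar>x\<bar> ^ n / fact n * Beta a d" for n
      using Beta_real_mono[of a "a + real n" d d] a d by (auto simp: abs_mult intro!: mult_left_mono divide_right_mono)
    then show "\<exists>N. \<forall>n\<ge>N. norm (\<integral>t. norm (f n t) \<partial>lborel) \<le> \<bar>x\<bar> ^ n / fact n * Beta a d"
      using has_bochner_integral_integral_eq[OF nf] by auto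
  qed
  have int: "integrable lborel (f n)" for n
    using f by (rule integrable.intros)
  have eq: "(\<lambda>t. \<Sum>n. f n t) = (\<lambda>t. indicator {0<..<1} t * (exp (x * t) * (t powr (a - 1) * (1 - t) powr (d - 1))))"
    using sums by (auto simp: sums_iff)
  have "integral\<^sup>L lborel (f n) = Beta a d * (pochhammer a n / pochhammer (a + d) n * x ^ n / fact n)" for n
    using has_bochner_integral_integral_eq[OF f, of n] a d by (simp add: Beta_plus_nat mult_ac)
  moreover have "(\<lambda>n. integral\<^sup>L lborel (f n)) sums (\<integral>t. (\<Sum>n. f n t) \<partial>lborel)"
    using int abs_summable summable_int by (intro sums_integral) auto
  ultimately have "(\<lambda>n. Beta a d * (pochhammer a n / pochhammer (a + d) n * x ^ n / fact n)) sums (\<integral>t. (\<Sum>n. f n t) \<partial>lborel)"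
    by simp
  moreover have "Beta a d > 0"
    unfolding Beta_def using a d by (intro divide_pos_pos mult_pos_pos Gamma_real_pos) auto
  ultimately have "(\<lambda>n. pochhammer a n / pochhammer (a + d) n * x ^ n / fact n) sums
      ((\<integral>t. (\<Sum>n. f n t) \<partial>lborel) / Beta a d)"
    by (intro sums_mult_D) auto
  then have "(\<integral>t. (\<Sum>n. f n t) \<partial>lborel) = Beta a d * kummer_M a (a + d) x"
    unfolding kummer_M_def using \<open>Beta a d > 0\<close> by (simp add: sums_iff)
  moreover have "integrable lborel (\<lambda>t. \<Sum>n. f n t)"
    using int abs_summable summable_int by (intro integrable_suminf) auto
  ultimately show ?thesis
    unfolding eq by (simp add: has_bochner_integral_iff)
qed

section \<open>Bessel functions of half-integer order\<close>

text \<open>Combines cosh t >= t^2 / 4 with completing the square in z t / 2 and |\<nu>| + 1; the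
  extra 1 leaves the factor exp(-t). The bound serves both for integrability and for the boundary
  term of the recurrence.\<close>

lemma bessel_K_integrand_bound:
  fixes \<nu> z t :: real
  assumes z: "z > 0" and t: "t \<ge> 0"
  shows "exp (- z * cosh t) * cosh (\<nu> * t) \<le> exp ((\<bar>\<nu>\<bar> + 1)\<^sup>2 / z) * exp (- t)"
proof -
  have "t\<^sup>2 / 4 \<le> exp t / 2"
    using exp_lower_Taylor_quadratic[OF t] t by simp
  also have "\<dots> \<le> cosh t"
    by (simp add: cosh_def)
  finally have "z * (t\<^sup>2 / 4) \<le> z * cosh t"
    using z by (intro mult_left_mono) auto
  moreover have "(\<bar>\<nu>\<bar> + 1) * t \<le> (\<bar>\<nu>\<bar> + 1)\<^sup>2 / z + z * (t\<^sup>2 / 4)"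
  proof -
    have "0 \<le> (z * t / 2 - (\<bar>\<nu>\<bar> + 1))\<^sup>2 / z"
      using z by simp
    also have "\<dots> = (\<bar>\<nu>\<bar> + 1)\<^sup>2 / z + z * (t\<^sup>2 / 4) - (\<bar>\<nu>\<bar> + 1) * t"
      using z by (simp add: power2_eq_square field_simps)
    finally show ?thesis
      by simp
  qed
  ultimately have "- z * cosh t + \<bar>\<nu> * t\<bar> \<le> (\<bar>\<nu>\<bar> + 1)\<^sup>2 / z - t"
    using t by (simp add: abs_mult algebra_simps)
  then have "exp (- z * cosh t) * exp \<bar>\<nu> * t\<bar> \<le> exp ((\<bar>\<nu>\<bar> + 1)\<^sup>2 / z) * exp (- t)"
    unfolding exp_add[symmetric] by simp
  moreover have "cosh (\<nu> * t) \<le> exp \<bar>\<nu> * t\<bar>"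
    by (auto simp: cosh_def abs_if)
  then have "exp (- z * cosh t) * cosh (\<nu> * t) \<le> exp (- z * cosh t) * exp \<bar>\<nu> * t\<bar>"
    by (rule mult_left_mono) simp
  ultimately show ?thesis
    by linarith
qed

lemma bessel_K_integrable:
  fixes \<nu> z :: real
  assumes z: "z > 0"
  shows "set_integrable lborel {0<..} (\<lambda>t. exp (- z * cosh t) * cosh (\<nu> * t))"
proof -
  have [measurable]: "(\<lambda>t::real. cosh t) \<in> borel_measurable borel" "(\<lambda>t::real. cosh (\<nu> * t)) \<in> borel_measurable borel"
    by (auto intro!: borel_measurable_continuous_onI continuous_intros)
  have "integrable lborel (\<lambda>t::real. indicator {0<..} t * (exp (- 1 * t) * t powr (1 - 1)))"
    by (rule integrable.intros[OF has_bochner_integral_Gamma]) auto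
  then have "integrable lborel (\<lambda>t. exp ((\<bar>\<nu>\<bar> + 1)\<^sup>2 / z) * (indicator {0<..} t * (exp (- 1 * t) * t powr (1 - 1))))"
    by (rule integrable_mult_right)
  then show ?thesis
    unfolding set_integrable_def
  proof (rule Bochner_Integration.integrable_bound)
    show "AE t in lborel. norm (indicator {0<..} t *\<^sub>R (exp (- z * cosh t) * cosh (\<nu> * t)))
        \<le> norm (exp ((\<bar>\<nu>\<bar> + 1)\<^sup>2 / z) * (indicator {0<..} t * (exp (- 1 * t) * t powr (1 - 1))))"
      using bessel_K_integrand_bound[OF z, of _ \<nu>] by (auto simp: indicator_def)
  qed simp
qed

lemma bessel_K_eq_greaterThan: "bessel_K \<nu> z = (LBINT t:{0<..}. exp (- z * cosh t) * cosh (\<nu> * t))"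
proof -
  have [measurable]: "(\<lambda>t::real. cosh t) \<in> borel_measurable borel" "(\<lambda>t::real. cosh (\<nu> * t)) \<in> borel_measurable borel"
    by (auto intro!: borel_measurable_continuous_onI continuous_intros)
  show ?thesis
    unfolding bessel_K_def set_lebesgue_integral_def
    by (intro integral_cong_AE) (use AE_lborel_singleton[of 0] in \<open>auto simp: indicator_def elim!: eventually_mono\<close>)
qed

lemma bessel_K_minus: "bessel_K (- \<nu>) z = bessel_K \<nu> z"
  by (simp add: bessel_K_def)

text \<open>Integration by parts: half the difference of the integrands of orders \<nu> + 1 and
  \<nu> - 1 is exp(-z cosh t) sinh t sinh(\<nu> t), and exp(-z cosh t) sinh t is the derivative of
  -exp(-z cosh t) / z. The boundary term vanishes at 0 and at infinity.\<close>

lemma bessel_K_recurrence: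
  assumes z: "z > 0"
  shows "bessel_K (\<nu> + 1) z = bessel_K (\<nu> - 1) z + 2 * \<nu> / z * bessel_K \<nu> z"
proof -
  define k where "k \<nu> t = exp (- z * cosh t) * cosh (\<nu> * t)" for \<nu> t :: real
  define F where "F t = - exp (- z * cosh t) * sinh (\<nu> * t) / z" for t
  have int: "set_integrable lborel {0<..} (k \<nu>)" for \<nu>
    unfolding k_def[abs_def] by (rule bessel_K_integrable[OF z])
  have K: "bessel_K \<nu> z = (LBINT t:{0<..}. k \<nu> t)" for \<nu>
    unfolding k_def by (rule bessel_K_eq_greaterThan)
  define f where "f t = (k (\<nu> + 1) t - k (\<nu> - 1) t) / 2 - \<nu> / z * k \<nu> t" for t
  have f_int: "set_integrable lborel {0<..} f"
    unfolding f_def[abs_def] by (intro set_integral_diff set_integrable_divide set_integrable_mult_right int)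
  have "(LBINT t:{0<..}. f t) = 0 - 0"
  proof (rule set_integral_FTC_greaterThan[OF _ _ f_int])
    show "(F has_real_derivative f t) (at t)" for t
    proof -
      have "k (\<nu> + 1) t - k (\<nu> - 1) t = 2 * (exp (- z * cosh t) * (sinh (\<nu> * t) * sinh t))"
        by (simp add: k_def cosh_add cosh_diff distrib_right left_diff_distrib algebra_simps)
      then show ?thesis
        unfolding F_def[abs_def] f_def using z
        by (auto intro!: derivative_eq_intros simp: k_def field_simps)
    qed
    show "isCont f t" for t
      unfolding f_def[abs_def] k_def using z by (intro continuous_intros) auto
    have "isCont F 0"
      unfolding F_def[abs_def] using z by (intro continuous_intros) auto
    then show "(F \<longlongrightarrow> 0) (at_right 0)"
      by (auto simp: isCont_def F_def intro: tendsto_mono[OF at_le])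
    show "(F \<longlongrightarrow> 0) at_top"
    proof (rule Lim_null_comparison)
      have "norm (F t) \<le> exp ((\<bar>\<nu>\<bar> + 1)\<^sup>2 / z) * exp (- t) / z" if "t \<ge> 0" for t
      proof -
        have "\<bar>sinh (\<nu> * t)\<bar> \<le> cosh (\<nu> * t)"
          by (simp add: abs_le_iff sinh_def cosh_def)
        then have "exp (- z * cosh t) * \<bar>sinh (\<nu> * t)\<bar> \<le> exp (- z * cosh t) * cosh (\<nu> * t)"
          by (rule mult_left_mono) simp
        also have "\<dots> \<le> exp ((\<bar>\<nu>\<bar> + 1)\<^sup>2 / z) * exp (- t)"
          by (rule bessel_K_integrand_bound[OF z that])
        finally show ?thesis
          using z by (simp add: F_def abs_mult divide_right_mono)
      qed
      then show "\<forall>\<^sub>F t in at_top. norm (F t) \<le> exp ((\<bar>\<nu>\<bar> + 1)\<^sup>2 / z) * exp (- t) / z"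
        using eventually_ge_at_top[of 0] by (rule eventually_mono[rotated])
      show "((\<lambda>t. exp ((\<bar>\<nu>\<bar> + 1)\<^sup>2 / z) * exp (- t) / z) \<longlongrightarrow> 0) at_top"
        by (intro tendsto_divide_zero tendsto_mult_right_zero) real_asymp
    qed
  qed
  moreover have "(LBINT t:{0<..}. f t) = (bessel_K (\<nu> + 1) z - bessel_K (\<nu> - 1) z) / 2 - \<nu> / z * bessel_K \<nu> z"
    unfolding f_def K by (simp add: set_integral_diff int)
  ultimately show ?thesis
    by (simp add: field_simps)
qed

text \<open>The substitution u = sqrt(2 z) sinh(t / 2) turns z cosh t into z + u^2 and absorbs
  cosh(t / 2) into du, which leaves half a Gaussian integral. Its inverse is the function
  \<open>g\<close>.\<close>

lemma bessel_K_half: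
  assumes z: "z > 0"
  shows "bessel_K (1/2) z = sqrt (pi / (2 * z)) * exp (- z)"
proof -
  define s where "s = sqrt (2 * z)"
  have s: "s > 0" "s\<^sup>2 = 2 * z"
    using z by (auto simp: s_def)
  define g where "g u = 2 * arsinh (u / s)" for u
  define g' where "g' u = 2 / (s * sqrt ((u / s)\<^sup>2 + 1))" for u
  define f where "f t = exp (- z * cosh t) * cosh (1 / 2 * t)" for t
  have fg: "f (g u) * g' u = 2 / s * exp (- z) * exp (- u\<^sup>2)" for u
  proof -
    have cosh_g: "cosh (1 / 2 * g u) = sqrt ((u / s)\<^sup>2 + 1)"
      by (simp add: g_def cosh_arsinh_real)
    have "cosh (g u) = 2 * (cosh (1 / 2 * g u))\<^sup>2 - 1"
      using cosh_double_cosh[of "1 / 2 * g u"] by simp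
    also have "\<dots> = 1 + 2 * (u / s)\<^sup>2"
      unfolding cosh_g by (simp add: add_nonneg_nonneg)
    finally have "z * cosh (g u) = z + u\<^sup>2"
      using s z by (simp add: power_divide field_simps)
    moreover have "sqrt ((u / s)\<^sup>2 + 1) > 0"
      by (simp add: add_nonneg_pos)
    ultimately show ?thesis
      unfolding f_def cosh_g g'_def using s by (simp add: exp_add[symmetric] exp_diff exp_minus field_simps)
  qed
  have gauss: "has_bochner_integral lborel (\<lambda>u. indicator {0<..} u * exp (- u\<^sup>2)) (sqrt pi / 2)"
  proof -
    have "has_bochner_integral lborel (\<lambda>u::real. indicator {0..} u *\<^sub>R exp (- u\<^sup>2)) (sqrt pi / 2)"
      by (rule gaussian_moment_0)
    then show ?thesis
      by (subst has_bochner_integral_cong_AE[where g = "\<lambda>u. indicator {0..} u *\<^sub>R exp (- u\<^sup>2)"])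
        (use AE_lborel_singleton[of 0] in \<open>auto simp: indicator_def elim!: eventually_mono\<close>)
  qed
  then have fg_int: "has_bochner_integral lborel (\<lambda>u. indicator {0<..} u * (f (g u) * g' u)) (2 / s * exp (- z) * (sqrt pi / 2))"
    unfolding fg using has_bochner_integral_mult_right[OF gauss, of "2 / s * exp (- z)"] by (simp add: mult_ac)
  have "(LBINT t=0..\<infinity>. f t) = (LBINT u=0..\<infinity>. f (g u) * g' u)"
  proof (rule interval_integral_substitution_nonneg(2))
    show "DERIV g u :> g' u" for u
    proof -
      have "((\<lambda>u. u / s) has_real_derivative 1 / s) (at u)"
        using s by (auto intro!: derivative_eq_intros)
      from DERIV_cmult[OF DERIV_chain2[OF arsinh_real_has_field_derivative this], of 2] show ?thesis
        unfolding g_def[abs_def] g'_def by (simp add: mult.commute add.commute)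
    qed
    show "isCont f (g u)" for u
      unfolding f_def[abs_def] by (intro continuous_intros)
    show "isCont g' u" for u
      unfolding g'_def[abs_def] using s
      by (intro continuous_intros) (auto simp: add_nonneg_eq_0_iff)
    show "0 \<le> f (g u)" for u
      by (simp add: f_def)
    show "0 \<le> g' u" for u
      using s by (simp add: g'_def)
    have "(g \<longlongrightarrow> g 0) (at 0)"
      unfolding g_def[abs_def] using s by (intro isCont_tendsto_compose[OF _ tendsto_ident_at] tendsto_intros isContD continuous_intros) auto
    then have "(g \<longlongrightarrow> 0) (at_right 0)"
      by (auto simp: g_def intro: tendsto_mono[OF at_le])
    then show "((ereal \<circ> g \<circ> real_of_ereal) \<longlongrightarrow> 0) (at_right 0)"
      unfolding zero_ereal_def at_right_ereal by (simp add: filterlim_filtermap comp_def)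
    have "filterlim g at_top at_top"
      unfolding g_def[abs_def] using s by real_asymp
    then show "((ereal \<circ> g \<circ> real_of_ereal) \<longlongrightarrow> \<infinity>) (at_left \<infinity>)"
      unfolding at_left_PInf by (simp add: filterlim_filtermap comp_def tendsto_PInfty_eq_at_top)
    show "set_integrable lborel (einterval 0 \<infinity>) (\<lambda>u. f (g u) * g' u)"
      using fg_int by (simp add: set_integrable_def has_bochner_integral_iff zero_ereal_def)
  qed simp
  then have "bessel_K (1/2) z = (LBINT u:{0<..}. f (g u) * g' u)"
    unfolding bessel_K_eq_greaterThan f_def[symmetric]
    by (simp add: interval_integral_to_infinity_eq zero_ereal_def)
  also have "\<dots> = 2 / s * exp (- z) * (sqrt pi / 2)"
    using fg_int by (simp add: set_lebesgue_integral_def has_bochner_integral_iff)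
  also have "\<dots> = sqrt (pi / (2 * z)) * exp (- z)"
    by (simp add: s_def real_sqrt_divide)
  finally show ?thesis .
qed

section \<open>The finite sum at half-integer order\<close>

text \<open>The coefficients of the Bessel polynomials. On natural numbers m - j truncates, so the
  value 0 for j > m is set explicitly; it lets the recurrence hold for all j.\<close>

definition bessel_coeff :: "nat \<Rightarrow> nat \<Rightarrow> real" where
  "bessel_coeff m j = (if j \<le> m then fact (m + j) / (fact (m - j) * fact j * 2 ^ j) else 0)"

lemma bessel_coeff_0 [simp]: "bessel_coeff m 0 = 1"
  by (simp add: bessel_coeff_def)

lemma bessel_coeff_eq_0 [simp]: "m < j \<Longrightarrow> bessel_coeff m j = 0"
  by (simp add: bessel_coeff_def)

text \<open>Comparison of the coefficients of z^(-j - 1) in the recurrence of K at order \<nu> = m +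
  3/2, where 2 \<nu> = 2 m + 3.\<close>

lemma bessel_coeff_rec:
  "bessel_coeff (Suc (Suc m)) (Suc j) = bessel_coeff m (Suc j) + (2 * real m + 3) * bessel_coeff (Suc m) j"
proof -
  \<comment> \<open>For j = m and j = Suc m the first summand on the right is one of the padded
    zeros; beyond that all three coefficients are.\<close>
  consider "j > Suc m" | "j = Suc m" | "j = m" | "Suc j \<le> m"
    by linarith
  then show ?thesis
  proof cases
    case 4
    then obtain k where "m = Suc j + k"
      using le_Suc_ex by blast
    then show ?thesis
      by (simp add: bessel_coeff_def Suc_diff_le divide_simps) (simp add: algebra_simps)
  next
    case 2
    then show ?thesis
      by (simp add: bessel_coeff_def divide_simps) (simp add: algebra_simps)
  next
    case 3
    then show ?thesis
      by (simp add: bessel_coeff_def divide_simps) (simp add: algebra_simps)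
  qed simp
qed

text \<open>The recurrence links three consecutive orders, so the induction needs two starting
  values. The second, at order 3/2, follows from the first because K is even in its order.\<close>

theorem bessel_K_half_integer:
  assumes z: "z > 0"
  shows "bessel_K (real m + 1/2) z = sqrt (pi / (2 * z)) * exp (- z) * (\<Sum>j\<le>m. bessel_coeff m j / z ^ j)"
proof (induction m rule: induct_nat_012)
  case 0
  show ?case
    using bessel_K_half[OF z] by simp
next
  case 1
  have "bessel_K (1/2 + 1) z = bessel_K (- (1/2)) z + 2 * (1/2) / z * bessel_K (1/2) z"
    using bessel_K_recurrence[OF z, of "1/2"] by simp
  also have "\<dots> = sqrt (pi / (2 * z)) * exp (- z) * (1 + 1 / z)"
    using z by (simp add: bessel_K_minus bessel_K_half[OF z] field_simps)
  finally show ?case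
    by (simp add: bessel_coeff_def)
next
  case (ge2 m)
  define E where "E = sqrt (pi / (2 * z)) * exp (- z)"
  define S where "S m = (\<Sum>j\<le>m. bessel_coeff m j / z ^ j)" for m
  have "S (Suc (Suc m)) = 1 + (\<Sum>j\<le>Suc m. bessel_coeff (Suc (Suc m)) (Suc j) / z ^ Suc j)"
    unfolding S_def by (subst sum.atMost_Suc_shift) simp
  also have "\<dots> = 1 + ((\<Sum>j\<le>Suc m. bessel_coeff m (Suc j) / z ^ Suc j)
      + (\<Sum>j\<le>Suc m. (2 * real m + 3) / z * (bessel_coeff (Suc m) j / z ^ j)))"
    unfolding sum.distrib[symmetric] bessel_coeff_rec
    by (intro arg_cong2[where f = "(+)"] sum.cong) (auto simp: add_divide_distrib distrib_right)
  also have "\<dots> = (\<Sum>j\<le>Suc (Suc m). bessel_coeff m j / z ^ j) + (2 * real m + 3) / z * S (Suc m)"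
    unfolding S_def sum_distrib_left by (subst (3) sum.atMost_Suc_shift) simp
  also have "(\<Sum>j\<le>Suc (Suc m). bessel_coeff m j / z ^ j) = S m"
    unfolding S_def by simp
  finally have S: "S (Suc (Suc m)) = S m + (2 * real m + 3) / z * S (Suc m)" .
  have "bessel_K (real (Suc (Suc m)) + 1/2) z = bessel_K (real m + 1/2) z + (2 * real m + 3) / z * bessel_K (real (Suc m) + 1/2) z"
    using bessel_K_recurrence[OF z, of "real (Suc m) + 1/2"] by (simp add: algebra_simps)
  also have "\<dots> = E * S m + (2 * real m + 3) / z * (E * S (Suc m))"
    using ge2 by (simp add: E_def S_def)
  also have "\<dots> = E * S (Suc (Suc m))"
    by (simp add: S algebra_simps)
  finally show ?case
    by (simp add: E_def S_def)
qed

section \<open>Absolute moments of the variance-gamma distribution\<close>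

lemma has_bochner_integral_affine:
  fixes f :: "real \<Rightarrow> real"
  assumes "has_bochner_integral lborel f I" "c \<noteq> 0"
  shows "has_bochner_integral lborel (\<lambda>y. f (t + c * y)) (I / \<bar>c\<bar>)"
  using assms lborel_has_bochner_integral_real_affine_iff[of c f I t] by (simp add: divide_inverse mult.commute)

lemma has_bochner_integral_tricomi_U:
  fixes p q c \<mu> :: real
  assumes p: "p > -1" and c: "c > 0" and \<mu>: "\<mu> > 0"
  shows "has_bochner_integral lborel
      (\<lambda>y. indicator {0<..} y * (exp (- c * y) * (y powr p * (y + \<mu>) powr q)))
      (\<mu> powr (p + q + 1) * (Gamma (p + 1) * tricomi_U (p + 1) (p + q + 2) (c * \<mu>)))"
proof -
  have "Gamma (p + 1) > 0"
    using p by (intro Gamma_real_pos) auto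
  then have "Gamma (p + 1) \<noteq> 0"
    by linarith
  moreover have "tricomi_U (p + 1) (p + q + 2) (c * \<mu>) = tricomi_integral p q (c * \<mu>) / Gamma (p + 1)"
    using tricomi_U_integral_representation[of "p + 1" "c * \<mu>" "p + q + 2"] p c \<mu> by simp
  ultimately have I: "tricomi_integral p q (c * \<mu>) = Gamma (p + 1) * tricomi_U (p + 1) (p + q + 2) (c * \<mu>)"
    by (metis mult.commute nonzero_eq_divide_eq)
  have "has_bochner_integral lborel (tricomi_integrand p q (c * \<mu>)) (tricomi_integral p q (c * \<mu>))"
    unfolding tricomi_integral_def using p c \<mu>
    by (intro has_bochner_integral_integrable integrable_tricomi_integrand) auto
  from has_bochner_integral_mult_right[OF has_bochner_integral_affine[OF this, of "1 / \<mu>" 0], of "\<mu> powr (p + q)"]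
  have int: "has_bochner_integral lborel (\<lambda>y. \<mu> powr (p + q) * tricomi_integrand p q (c * \<mu>) (0 + 1 / \<mu> * y))
      (\<mu> powr (p + q) * (tricomi_integral p q (c * \<mu>) / \<bar>1 / \<mu>\<bar>))"
    using \<mu> by simp
  have const: "\<mu> powr (p + q) * (tricomi_integral p q (c * \<mu>) / \<bar>1 / \<mu>\<bar>) =
      \<mu> powr (p + q + 1) * tricomi_integral p q (c * \<mu>)"
    using \<mu> by (simp add: powr_add)
  have integrand: "\<mu> powr (p + q) * tricomi_integrand p q (c * \<mu>) (0 + 1 / \<mu> * y) =
      indicator {0<..} y * (exp (- c * y) * (y powr p * (y + \<mu>) powr q))" for y
  proof (cases "y > 0")
    case True
    have "1 + y / \<mu> = (y + \<mu>) / \<mu>"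
      using \<mu> by (simp add: field_simps)
    then have "\<mu> powr (p + q) * ((y / \<mu>) powr p * (1 + y / \<mu>) powr q) = y powr p * (y + \<mu>) powr q"
      using True \<mu> by (simp add: powr_divide powr_add)
    then show ?thesis
      using True \<mu> by (simp add: tricomi_integrand_def mult.left_commute)
  next
    case False
    then show ?thesis
      using \<mu> by (simp add: tricomi_integrand_def zero_less_divide_iff)
  qed
  show ?thesis
    using int unfolding const integrand unfolding I .
qed

text \<open>The Laplace representation yields U(r + 1, r + k + 2, c \<mu>). The power transformation
  trades it for U(-k, -k - r, c \<mu>), a polynomial in its argument, and the power of \<mu>
  cancels.\<close>

lemma has_bochner_integral_tricomi_U_polynomial:
  fixes r c \<mu> :: real and k :: nat
  assumes r: "r > -1" and c: "c > 0" and \<mu>: "\<mu> > 0"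
  shows "has_bochner_integral lborel
      (\<lambda>y. indicator {0<..} y * (exp (- c * y) * (y powr r * (y + \<mu>) powr real k)))
      (Gamma (r + 1) / c powr (r + real k + 1) * tricomi_U (- real k) (- real k - r) (c * \<mu>))"
proof -
  have "tricomi_U (- real k) (- real k - r) (c * \<mu>) =
      (c * \<mu>) powr (r + real k + 1) * tricomi_U (r + 1) (r + real k + 2) (c * \<mu>)"
    using tricomi_U_transform[of "r + 1" "c * \<mu>" "r + real k + 2"] r c \<mu>
    by (simp add: add_ac diff_diff_eq2 minus_diff_commute)
  then have "Gamma (r + 1) / c powr (r + real k + 1) * tricomi_U (- real k) (- real k - r) (c * \<mu>) =
      \<mu> powr (r + real k + 1) * (Gamma (r + 1) * tricomi_U (r + 1) (r + real k + 2) (c * \<mu>))"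
    using c \<mu> by (simp add: powr_mult)
  then show ?thesis
    using has_bochner_integral_tricomi_U[OF r c \<mu>, of "real k"] by simp
qed

lemma has_bochner_integral_kummer_M_scaled:
  fixes p r c \<mu> :: real
  assumes p: "p > -1" and r: "r > -1" and \<mu>: "\<mu> > 0"
  shows "has_bochner_integral lborel
      (\<lambda>y. indicator {0<..<\<mu>} y * (exp (- c * y) * (y powr p * (\<mu> - y) powr r)))
      (\<mu> powr (r + p + 1) * Beta (r + 1) (p + 1) * kummer_M (p + 1) (r + p + 2) (- c * \<mu>))"
proof -
  define f where "f t = indicator {0<..<1} t * (exp (- c * \<mu> * t) * (t powr p * (1 - t) powr r))" for t :: real
  define I where "I = Beta (r + 1) (p + 1) * kummer_M (p + 1) (r + p + 2) (- c * \<mu>)"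
  have "has_bochner_integral lborel f I"
    using has_bochner_integral_kummer_M[of "p + 1" "r + 1" "- c * \<mu>"] p r
    by (simp add: f_def[abs_def] I_def Beta_commute[of "1 + r"] add_ac)
  from has_bochner_integral_mult_right[OF has_bochner_integral_affine[OF this, of "1 / \<mu>" 0], of "\<mu> powr (p + r)"]
  have int: "has_bochner_integral lborel (\<lambda>y. \<mu> powr (p + r) * f (0 + 1 / \<mu> * y)) (\<mu> powr (p + r) * (I / \<bar>1 / \<mu>\<bar>))"
    using \<mu> by simp
  have const: "\<mu> powr (p + r) * (I / \<bar>1 / \<mu>\<bar>) = \<mu> powr (r + p + 1) * I"
    using \<mu> by (simp add: powr_add)
  have integrand: "\<mu> powr (p + r) * f (0 + 1 / \<mu> * y) =
      indicator {0<..<\<mu>} y * (exp (- c * y) * (y powr p * (\<mu> - y) powr r))" for y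
  proof (cases "0 < y \<and> y < \<mu>")
    case True
    have "1 - y / \<mu> = (\<mu> - y) / \<mu>"
      using \<mu> by (simp add: field_simps)
    then have "\<mu> powr (p + r) * ((y / \<mu>) powr p * (1 - y / \<mu>) powr r) = y powr p * (\<mu> - y) powr r"
      using True \<mu> by (simp add: powr_divide powr_add)
    then show ?thesis
      using True \<mu> by (simp add: f_def mult.left_commute)
  next
    case False
    then show ?thesis
      using \<mu> by (auto simp: f_def indicator_def field_simps)
  qed
  show ?thesis
    using int unfolding const integrand unfolding I_def by (simp only: mult.assoc)
qed

section \<open>Moments of the elementary components\<close>

text \<open>The weight |x|^r times one term of the expanded density, up to constants, in the centred
  variable y = x - \<mu>.\<close>

definition vg_component :: "real \<Rightarrow> real \<Rightarrow> real \<Rightarrow> real \<Rightarrow> nat \<Rightarrow> real \<Rightarrow> real" where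
  "vg_component \<alpha> \<beta> \<mu> r k y = \<bar>y + \<mu>\<bar> powr r * (\<bar>y\<bar> powr real k * exp (\<beta> * y - \<alpha> * \<bar>y\<bar>))"

lemma vg_component_measurable [measurable]: "vg_component \<alpha> \<beta> \<mu> r k \<in> borel_measurable borel"
  unfolding vg_component_def[abs_def] by measurable

lemma vg_component_integral_pos:
  assumes \<beta>: "\<bar>\<beta>\<bar> < \<alpha>" and \<mu>: "\<mu> > 0" and r: "r > -1"
  shows "has_bochner_integral lborel (vg_component \<alpha> \<beta> \<mu> r k)
     (exp (- \<alpha> * \<mu> - \<beta> * \<mu>) * Gamma (r + 1) / (\<alpha> + \<beta>) powr (r + real k + 1)
        * tricomi_U (- real k) (- real k - r) (\<alpha> * \<mu> + \<beta> * \<mu>)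
      + \<mu> powr (r + real k + 1) * Beta (r + 1) (real k + 1)
        * kummer_M (real k + 1) (r + real k + 2) (- \<alpha> * \<mu> - \<beta> * \<mu>)
      + \<mu> powr (r + real k + 1) * fact k * tricomi_U (real k + 1) (r + real k + 2) (\<alpha> * \<mu> - \<beta> * \<mu>))"
    (is "has_bochner_integral _ _ (?I1 + ?I2 + ?I3)")
proof -
  have pos: "\<alpha> + \<beta> > 0" "\<alpha> - \<beta> > 0"
    using \<beta> by auto
  define f1 where "f1 y = indicator {0<..} y * (exp (- (\<alpha> + \<beta>) * y) * (y powr r * (y + \<mu>) powr real k))" for y :: real
  define f2 where "f2 y = indicator {0<..<\<mu>} y * (exp (- (\<alpha> + \<beta>) * y) * (y powr real k * (\<mu> - y) powr r))" for y :: real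
  define f3 where "f3 y = indicator {0<..} y * (exp (- (\<alpha> - \<beta>) * y) * (y powr real k * (y + \<mu>) powr r))" for y :: real
  have [measurable]: "f1 \<in> borel_measurable borel" "f2 \<in> borel_measurable borel" "f3 \<in> borel_measurable borel"
    unfolding f1_def[abs_def] f2_def[abs_def] f3_def[abs_def] by measurable
  have "has_bochner_integral lborel f1
      (Gamma (r + 1) / (\<alpha> + \<beta>) powr (r + real k + 1) * tricomi_U (- real k) (- real k - r) ((\<alpha> + \<beta>) * \<mu>))"
    unfolding f1_def using r pos \<mu> by (intro has_bochner_integral_tricomi_U_polynomial)
  \<comment> \<open>The map y -> -\<mu> - y carries the half-line below -\<mu> to the positive one.
    The prefactor is the value of exp(\<beta> y - \<alpha> |y|) at the break point y =
    -\<mu>.\<close>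
  from has_bochner_integral_mult_right[OF has_bochner_integral_affine[OF this, of "-1" "- \<mu>"], of "exp (- \<alpha> * \<mu> - \<beta> * \<mu>)"]
  have 1: "has_bochner_integral lborel (\<lambda>y. exp (- \<alpha> * \<mu> - \<beta> * \<mu>) * f1 (- \<mu> + (-1) * y)) ?I1"
    by (simp add: distrib_right mult.assoc)
  have "has_bochner_integral lborel f2 (\<mu> powr (r + real k + 1) * Beta (r + 1) (real k + 1)
      * kummer_M (real k + 1) (r + real k + 2) (- (\<alpha> + \<beta>) * \<mu>))"
    unfolding f2_def using r \<mu> by (intro has_bochner_integral_kummer_M_scaled) auto
  from has_bochner_integral_affine[OF this, of "-1" 0]
  have 2: "has_bochner_integral lborel (\<lambda>y. f2 (0 + (-1) * y)) ?I2"
    by (simp add: left_diff_distrib)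
  have "has_bochner_integral lborel f3 (\<mu> powr (real k + r + 1) * (Gamma (real k + 1)
      * tricomi_U (real k + 1) (real k + r + 2) ((\<alpha> - \<beta>) * \<mu>)))"
    unfolding f3_def using r pos \<mu> by (intro has_bochner_integral_tricomi_U) auto
  moreover have "\<mu> powr (real k + r + 1) * (Gamma (real k + 1) * tricomi_U (real k + 1) (real k + r + 2) ((\<alpha> - \<beta>) * \<mu>)) = ?I3"
    by (simp add: Gamma_fact[symmetric] add_ac left_diff_distrib)
  ultimately have 3: "has_bochner_integral lborel f3 ?I3"
    by simp
  \<comment> \<open>The open indicators leave out the break points 0 and -\<mu>, a null set.\<close>
  have "AE y in lborel. vg_component \<alpha> \<beta> \<mu> r k y =
      exp (- \<alpha> * \<mu> - \<beta> * \<mu>) * f1 (- \<mu> + (-1) * y) + f2 (0 + (-1) * y) + f3 y"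
    using AE_lborel_singleton[of 0] AE_lborel_singleton[of "- \<mu>"]
  proof eventually_elim
    case (elim y)
    then consider "y > 0" | "- \<mu> < y" "y < 0" | "y < - \<mu>"
      by linarith
    then show ?case
    proof cases
      case 1
      then show ?thesis
        using \<mu> by (simp add: vg_component_def f1_def f2_def f3_def algebra_simps)
    next
      case 2
      then show ?thesis
        using \<mu> by (simp add: vg_component_def f1_def f2_def f3_def algebra_simps)
    next
      case 3
      then have "exp (- \<alpha> * \<mu> - \<beta> * \<mu>) * exp (- (\<alpha> + \<beta>) * (- \<mu> - y)) = exp (\<beta> * y - \<alpha> * \<bar>y\<bar>)"
        using \<mu> by (simp add: exp_add[symmetric] algebra_simps)
      moreover have abs_y\<mu>: "\<bar>y + \<mu>\<bar> = - \<mu> - y"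
        using 3 by linarith
      ultimately have "exp (- \<alpha> * \<mu> - \<beta> * \<mu>) * f1 (- \<mu> + (-1) * y) = vg_component \<alpha> \<beta> \<mu> r k y"
        using 3 \<mu> by (simp add: vg_component_def f1_def abs_y\<mu>)
      then show ?thesis
        using 3 \<mu> by (simp add: f2_def f3_def)
    qed
  qed
  then show ?thesis
    using has_bochner_integral_add[OF has_bochner_integral_add[OF 1 2] 3]
    by (subst has_bochner_integral_cong_AE) auto
qed

text \<open>Reflection replaces (\<beta>, \<mu>) by (-\<beta>, -\<mu>). The product \<beta> \<mu> is
  invariant, so the sign of \<mu> shows only in the base \<alpha> + sgn(\<mu>) \<beta>.\<close>

lemma vg_component_integral:
  assumes \<beta>: "\<bar>\<beta>\<bar> < \<alpha>" and \<mu>: "\<mu> \<noteq> 0" and r: "r > -1"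
  shows "has_bochner_integral lborel (vg_component \<alpha> \<beta> \<mu> r k)
     (exp (- \<alpha> * \<bar>\<mu>\<bar> - \<beta> * \<mu>) * Gamma (r + 1) / (\<alpha> + sgn \<mu> * \<beta>) powr (r + real k + 1)
        * tricomi_U (- real k) (- real k - r) (\<alpha> * \<bar>\<mu>\<bar> + \<beta> * \<mu>)
      + \<bar>\<mu>\<bar> powr (r + real k + 1) * Beta (r + 1) (real k + 1)
        * kummer_M (real k + 1) (r + real k + 2) (- \<alpha> * \<bar>\<mu>\<bar> - \<beta> * \<mu>)
      + \<bar>\<mu>\<bar> powr (r + real k + 1) * fact k * tricomi_U (real k + 1) (r + real k + 2) (\<alpha> * \<bar>\<mu>\<bar> - \<beta> * \<mu>))"
proof (cases "\<mu> > 0")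
  case True
  then show ?thesis
    using vg_component_integral_pos[OF \<beta> True r, of k] by simp
next
  case False
  then have neg: "\<mu> < 0"
    using \<mu> by simp
  have reflect: "vg_component \<alpha> (- \<beta>) (- \<mu>) r k (0 + (-1) * y) = vg_component \<alpha> \<beta> \<mu> r k y" for y
  proof -
    have "\<bar>- y + - \<mu>\<bar> = \<bar>y + \<mu>\<bar>"
      by linarith
    then show ?thesis
      by (simp add: vg_component_def)
  qed
  have "\<bar>- \<beta>\<bar> < \<alpha>" "- \<mu> > 0"
    using \<beta> neg by auto
  from has_bochner_integral_affine[OF vg_component_integral_pos[OF this r, of k], of "-1" 0] neg show ?thesis
    unfolding reflect by simp
qed

text \<open>At \<mu> = 0 the two powers merge into |y|^(r + k), so each half-line contributes a
  Gamma integral of shape r + k + 1 with its own rate.\<close>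

lemma vg_component_integral_zero:
  assumes \<beta>: "\<bar>\<beta>\<bar> < \<alpha>" and r: "r > -1"
  shows "has_bochner_integral lborel (vg_component \<alpha> \<beta> 0 r k)
     (Gamma (r + real k + 1) / (\<alpha> + \<beta>) powr (r + real k + 1)
      + Gamma (r + real k + 1) / (\<alpha> - \<beta>) powr (r + real k + 1))"
proof -
  define f where "f c y = indicator {0<..} y * (exp (- c * y) * y powr (r + real k + 1 - 1))" for c y :: real
  have [measurable]: "f c \<in> borel_measurable borel" for c
    unfolding f_def[abs_def] by measurable
  have f: "has_bochner_integral lborel (f c) (Gamma (r + real k + 1) / c powr (r + real k + 1))" if "c > 0" for c
    unfolding f_def using r that by (intro has_bochner_integral_Gamma) auto
  have "has_bochner_integral lborel (\<lambda>y. f (\<alpha> + \<beta>) (0 + (-1) * y) + f (\<alpha> - \<beta>) y)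
     (Gamma (r + real k + 1) / (\<alpha> + \<beta>) powr (r + real k + 1) / \<bar>-1\<bar>
      + Gamma (r + real k + 1) / (\<alpha> - \<beta>) powr (r + real k + 1))"
    using \<beta> by (intro has_bochner_integral_add has_bochner_integral_affine f) auto
  moreover have "AE y in lborel. vg_component \<alpha> \<beta> 0 r k y = f (\<alpha> + \<beta>) (0 + (-1) * y) + f (\<alpha> - \<beta>) y"
    using AE_lborel_singleton[of 0]
  proof eventually_elim
    case (elim y)
    then consider "y > 0" | "y < 0"
      by linarith
    then show ?case
      by cases (simp_all add: vg_component_def f_def powr_add algebra_simps)
  qed
  ultimately show ?thesis
    by (subst has_bochner_integral_cong_AE) auto
qed

section \<open>From the components to the density and its absolute moments\<close>

lemma bessel_K_nonneg: "bessel_K \<nu> z \<ge> 0"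
  unfolding bessel_K_def set_lebesgue_integral_def by (intro Bochner_Integration.integral_nonneg) (simp add: indicator_def)

lemma vg_pdf_nonneg:
  assumes "\<nu> > -1/2"
  shows "vg_pdf \<nu> \<alpha> \<beta> \<mu> x \<ge> 0"
proof -
  have "Gamma (\<nu> + 1/2) > 0"
    using assms by (intro Gamma_real_pos) auto
  then show ?thesis
    unfolding vg_pdf_def by (intro mult_nonneg_nonneg divide_nonneg_nonneg bessel_K_nonneg) auto
qed

lemma vg_pdf_half_integer:
  assumes \<beta>: "\<bar>\<beta>\<bar> < \<alpha>" and x: "x \<noteq> \<mu>"
  shows "vg_pdf (real m + 1/2) \<alpha> \<beta> \<mu> x =
    (\<Sum>j=0..m. (\<alpha>\<^sup>2 - \<beta>\<^sup>2) ^ (m + 1) / ((2 * \<alpha>) ^ (m + 1) * fact m) * (bessel_coeff m j / \<alpha> ^ j)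
       * (\<bar>x - \<mu>\<bar> powr real (m - j) * exp (\<beta> * (x - \<mu>) - \<alpha> * \<bar>x - \<mu>\<bar>)))"
proof -
  define y where "y = \<bar>x - \<mu>\<bar>"
  have y: "y > 0" and \<alpha>: "\<alpha> > 0"
    using \<beta> x by (auto simp: y_def)
  have "\<bar>\<beta>\<bar>\<^sup>2 < \<alpha>\<^sup>2"
    using \<beta> by (intro power_strict_mono) auto
  then have sq: "\<alpha>\<^sup>2 - \<beta>\<^sup>2 > 0"
    by simp
  have half: "u powr (real m + 1/2) = u ^ m * sqrt u" if "u > 0" for u :: real
    using that by (simp add: powr_add powr_realpow powr_half_sqrt)
  have "Gamma (real m + 1/2 + 1/2) = fact m"
    by (simp add: Gamma_fact[symmetric] add.commute)
  moreover have "(\<alpha>\<^sup>2 - \<beta>\<^sup>2) powr (real m + 1/2 + 1/2) = (\<alpha>\<^sup>2 - \<beta>\<^sup>2) ^ (m + 1)"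
    using powr_realpow[OF sq, of "m + 1"] by (simp add: add.commute)
  ultimately have pdf: "vg_pdf (real m + 1/2) \<alpha> \<beta> \<mu> x =
      (\<alpha>\<^sup>2 - \<beta>\<^sup>2) ^ (m + 1) / (sqrt pi * ((2 * \<alpha>) ^ m * sqrt (2 * \<alpha>)) * fact m) * exp (\<beta> * (x - \<mu>)) * (y ^ m * sqrt y)
      * (sqrt (pi / (2 * (\<alpha> * y))) * exp (- (\<alpha> * y)) * (\<Sum>j\<le>m. bessel_coeff m j / (\<alpha> * y) ^ j))"
    unfolding vg_pdf_def y_def[symmetric] using \<alpha> y by (simp add: half bessel_K_half_integer)
  \<comment> \<open>Here s, t, u stand for the square roots of pi, 2 \<alpha> and y. The first and
    last cancel between the normalization and the Bessel function, while the two copies of t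
    complete (2 \<alpha>)^m to (2 \<alpha>)^(m + 1).\<close>
  have cancel: "P / (s * (A * t) * F) * e * (Y * u) * (s / (t * u) * e' * S) = P / (A * (t * t) * F) * (e * e') * (Y * S)"
    if "s \<noteq> 0" "t \<noteq> 0" "u \<noteq> 0" for P s A t F e Y u e' S :: real
    using that by (simp add: field_simps)
  have root: "sqrt (2 * \<alpha>) * sqrt (2 * \<alpha>) = 2 * \<alpha>"
    using \<alpha> by simp
  have "sqrt (pi / (2 * (\<alpha> * y))) = sqrt pi / (sqrt (2 * \<alpha>) * sqrt y)"
    by (simp add: real_sqrt_divide real_sqrt_mult mult.assoc)
  then have "vg_pdf (real m + 1/2) \<alpha> \<beta> \<mu> x =
      (\<alpha>\<^sup>2 - \<beta>\<^sup>2) ^ (m + 1) / ((2 * \<alpha>) ^ m * (sqrt (2 * \<alpha>) * sqrt (2 * \<alpha>)) * fact m)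
      * (exp (\<beta> * (x - \<mu>)) * exp (- (\<alpha> * y))) * (y ^ m * (\<Sum>j\<le>m. bessel_coeff m j / (\<alpha> * y) ^ j))"
    unfolding pdf using \<alpha> y by (simp only:) (rule cancel, auto)
  also have "y ^ m * (\<Sum>j\<le>m. bessel_coeff m j / (\<alpha> * y) ^ j) = (\<Sum>j=0..m. bessel_coeff m j / \<alpha> ^ j * y powr real (m - j))"
    unfolding sum_distrib_left atMost_atLeast0
  proof (rule sum.cong)
    fix j assume "j \<in> {0..m}"
    then have "y ^ m = y ^ j * y ^ (m - j)"
      by (simp add: power_add[symmetric])
    then show "y ^ m * (bessel_coeff m j / (\<alpha> * y) ^ j) = bessel_coeff m j / \<alpha> ^ j * y powr real (m - j)"
      using y by (simp add: powr_realpow power_mult_distrib)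
  qed simp
  finally show ?thesis
    unfolding root y_def[symmetric] sum_distrib_left exp_add[symmetric]
    by (simp add: mult_ac)
qed

text \<open>Keeping the component integrals abstract as \<open>V\<close> lets \<mu> = 0 and \<mu>
  \<noteq> 0 share the summation and the bookkeeping of constants.\<close>

lemma vg_abs_moment:
  assumes \<beta>: "\<bar>\<beta>\<bar> < \<alpha>"
    and pdf [measurable]: "vg_pdf (real m + 1/2) \<alpha> \<beta> \<mu> \<in> borel_measurable borel"
    and V: "\<And>k. has_bochner_integral lborel (vg_component \<alpha> \<beta> \<mu> r k) (V k)"
  shows "has_bochner_integral lborel (\<lambda>x. vg_pdf (real m + 1/2) \<alpha> \<beta> \<mu> x * \<bar>x\<bar> powr r)
    ((1 - \<beta>\<^sup>2 / \<alpha>\<^sup>2) ^ (m + 1) / (2 ^ (m + 1) * fact m * \<alpha> powr r) *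
     (\<Sum>j=0..m. fact (m + j) / (fact (m - j) * fact j * 2 ^ j) * (\<alpha> powr (r + real (m - j) + 1) * V (m - j))))"
proof -
  have \<alpha>: "\<alpha> > 0"
    using \<beta> by auto
  define C where "C = (\<alpha>\<^sup>2 - \<beta>\<^sup>2) ^ (m + 1) / ((2 * \<alpha>) ^ (m + 1) * fact m)"
  define D where "D = (1 - \<beta>\<^sup>2 / \<alpha>\<^sup>2) ^ (m + 1) / (2 ^ (m + 1) * fact m * \<alpha> powr r)"
  \<comment> \<open>Factoring \<alpha>^2 out of \<alpha>^2 - \<beta>^2 leaves a surplus of
    \<alpha>^(m + 1), hence \<alpha>^(m - j + 1) in the j-th term; the remaining \<alpha>^r
    compensates the one in the denominator of \<open>D\<close>.\<close>
  have C: "C * (1 / \<alpha> ^ j) = D * \<alpha> powr (r + real (m - j) + 1)" if "j \<le> m" for j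
  proof -
    have "\<alpha>\<^sup>2 - \<beta>\<^sup>2 = \<alpha> * \<alpha> * (1 - \<beta>\<^sup>2 / \<alpha>\<^sup>2)"
      using \<alpha> by (simp add: field_simps power2_eq_square)
    then have "(\<alpha>\<^sup>2 - \<beta>\<^sup>2) ^ (m + 1) = \<alpha> ^ (m + 1) * \<alpha> ^ (m + 1) * (1 - \<beta>\<^sup>2 / \<alpha>\<^sup>2) ^ (m + 1)"
      by (simp only: power_mult_distrib)
    then have "C = \<alpha> ^ (m + 1) * ((1 - \<beta>\<^sup>2 / \<alpha>\<^sup>2) ^ (m + 1) / (2 ^ (m + 1) * fact m))"
      unfolding C_def power_mult_distrib using \<alpha> by (simp del: power_Suc)
    moreover have "\<alpha> ^ (m + 1) = \<alpha> ^ (m - j + 1) * \<alpha> ^ j"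
      using that by (simp add: power_add[symmetric])
    moreover have "\<alpha> powr (r + real (m - j) + 1) = \<alpha> powr r * \<alpha> ^ (m - j + 1)"
      using \<alpha> by (simp add: powr_add powr_realpow mult.assoc)
    ultimately show ?thesis
      using \<alpha> by (simp add: D_def)
  qed
  define f where "f x = (\<Sum>j=0..m. C * (bessel_coeff m j / \<alpha> ^ j) * vg_component \<alpha> \<beta> \<mu> r (m - j) (- \<mu> + 1 * x))" for x
  have [measurable]: "f \<in> borel_measurable borel"
    unfolding f_def[abs_def] by measurable
  have "has_bochner_integral lborel f (\<Sum>j=0..m. C * (bessel_coeff m j / \<alpha> ^ j) * (V (m - j) / \<bar>1\<bar>))"
    unfolding f_def by (intro has_bochner_integral_sum has_bochner_integral_mult_right has_bochner_integral_affine V) auto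
  also have "(\<Sum>j=0..m. C * (bessel_coeff m j / \<alpha> ^ j) * (V (m - j) / \<bar>1\<bar>)) =
      D * (\<Sum>j=0..m. fact (m + j) / (fact (m - j) * fact j * 2 ^ j) * (\<alpha> powr (r + real (m - j) + 1) * V (m - j)))"
    unfolding sum_distrib_left
  proof (rule sum.cong)
    fix j assume "j \<in> {0..m}"
    then have "j \<le> m"
      by simp
    have "C * (bessel_coeff m j / \<alpha> ^ j) * (V (m - j) / \<bar>1\<bar>) = C * (1 / \<alpha> ^ j) * (bessel_coeff m j * V (m - j))"
      by simp
    also have "\<dots> = D * (bessel_coeff m j * (\<alpha> powr (r + real (m - j) + 1) * V (m - j)))"
      unfolding C[OF \<open>j \<le> m\<close>] by (simp only: mult_ac)
    finally show "C * (bessel_coeff m j / \<alpha> ^ j) * (V (m - j) / \<bar>1\<bar>) =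
        D * (fact (m + j) / (fact (m - j) * fact j * 2 ^ j) * (\<alpha> powr (r + real (m - j) + 1) * V (m - j)))"
      using \<open>j \<le> m\<close> by (simp add: bessel_coeff_def)
  qed simp
  finally have int: "has_bochner_integral lborel f \<dots>" .
  have "AE x in lborel. vg_pdf (real m + 1/2) \<alpha> \<beta> \<mu> x * \<bar>x\<bar> powr r = f x"
    using AE_lborel_singleton[of \<mu>]
  proof eventually_elim
    case (elim x)
    have "vg_component \<alpha> \<beta> \<mu> r k (- \<mu> + 1 * x) =
        \<bar>x - \<mu>\<bar> powr real k * exp (\<beta> * (x - \<mu>) - \<alpha> * \<bar>x - \<mu>\<bar>) * \<bar>x\<bar> powr r" for k
      by (simp add: vg_component_def)
    then show ?case
      unfolding vg_pdf_half_integer[OF \<beta> elim] f_def C_def[symmetric] sum_distrib_right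
      by (simp only: mult.assoc)
  qed
  then show ?thesis
    unfolding D_def[symmetric] using int by (subst has_bochner_integral_cong_AE) auto
qed

(* For \<mu> = 0 the Gamma factor is Gamma (r + m - j + 1). The source prints Gamma (r + 1) there,
   which is false for m \<ge> 1 (for m = 1, \<beta> = 0, r = 2 it gives 2 / \<alpha>^2, the variance is 4 / \<alpha>^2)
   and disagrees with the limit \<mu> \<rightarrow> 0 of the formula for \<mu> \<noteq> 0. *)
theorem theorem2p6:
  fixes M :: "'a measure" and X :: "'a \<Rightarrow> real"
    and m :: nat and \<nu> \<alpha> \<beta> \<mu> r :: real
  assumes "prob_space M"
    and "\<nu> = real m + 1/2"
    and "\<bar>\<beta>\<bar> < \<alpha>"
    and "distributed M lborel X (\<lambda>x. ennreal (vg_pdf \<nu> \<alpha> \<beta> \<mu> x))"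
    and "r > -1"
  shows "integrable M (\<lambda>\<omega>. \<bar>X \<omega>\<bar> powr r) \<and>
    (\<mu> \<noteq> 0 \<longrightarrow>
      prob_space.expectation M (\<lambda>\<omega>. \<bar>X \<omega>\<bar> powr r) =
        (1 - \<beta>\<^sup>2 / \<alpha>\<^sup>2) ^ (m + 1) / (2 ^ (m + 1) * fact m * \<alpha> powr r) *
        (\<Sum>j=0..m. fact (m + j) / (fact (m - j) * fact j * 2 ^ j) *
          (exp (- \<alpha> * \<bar>\<mu>\<bar> - \<beta> * \<mu>) * Gamma (r + 1)
              / (1 + sgn \<mu> * \<beta> / \<alpha>) powr (r + real m - real j + 1)
              * tricomi_U (real j - real m) (real j - real m - r) (\<alpha> * \<bar>\<mu>\<bar> + \<beta> * \<mu>)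
           + (\<alpha> * \<bar>\<mu>\<bar>) powr (r + real m - real j + 1) * Beta (r + 1) (real m - real j + 1)
              * kummer_M (real m - real j + 1) (r + real m - real j + 2) (- \<alpha> * \<bar>\<mu>\<bar> - \<beta> * \<mu>)
           + (\<alpha> * \<bar>\<mu>\<bar>) powr (r + real m - real j + 1) * fact (m - j)
              * tricomi_U (real m - real j + 1) (r + real m - real j + 2) (\<alpha> * \<bar>\<mu>\<bar> - \<beta> * \<mu>)))) \<and>
    (\<mu> = 0 \<longrightarrow>
      prob_space.expectation M (\<lambda>\<omega>. \<bar>X \<omega>\<bar> powr r) =
        (1 - \<beta>\<^sup>2 / \<alpha>\<^sup>2) ^ (m + 1) / (2 ^ (m + 1) * fact m * \<alpha> powr r) *
        (\<Sum>j=0..m. fact (m + j) / (fact (m - j) * fact j * 2 ^ j) *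
          (Gamma (r + real m - real j + 1) / (1 + \<beta> / \<alpha>) powr (r + real m - real j + 1)
           + Gamma (r + real m - real j + 1) / (1 - \<beta> / \<alpha>) powr (r + real m - real j + 1))))"
proof -
  have \<alpha>: "\<alpha> > 0"
    using assms(3) by auto
  have \<beta>: "\<beta> < \<alpha>" "- \<beta> < \<alpha>"
    using assms(3) by auto
  have \<nu>: "\<nu> = real m + 1/2"
    by (fact assms(2))
  have nonneg: "0 \<le> vg_pdf \<nu> \<alpha> \<beta> \<mu> x" for x
    using \<nu> by (intro vg_pdf_nonneg) auto
  have [measurable]: "vg_pdf \<nu> \<alpha> \<beta> \<mu> \<in> borel_measurable borel"
    using distributed_real_measurable[OF _ assms(4)] nonneg by simp
  have expectation: "integrable M (\<lambda>\<omega>. \<bar>X \<omega>\<bar> powr r) \<and> (\<integral>\<omega>. \<bar>X \<omega>\<bar> powr r \<partial>M) = I"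
    if "has_bochner_integral lborel (\<lambda>x. vg_pdf \<nu> \<alpha> \<beta> \<mu> x * \<bar>x\<bar> powr r) I" for I
    using that distributed_integrable[OF assms(4), of "\<lambda>x. \<bar>x\<bar> powr r"]
      distributed_integral[OF assms(4), of "\<lambda>x. \<bar>x\<bar> powr r"] nonneg
    by (simp add: has_bochner_integral_iff)
  \<comment> \<open>The power of \<alpha> attached to each component integral is spent here on
    passing from \<alpha> + b to 1 + b / \<alpha>.\<close>
  have scale: "Z / (1 + b / \<alpha>) powr s = \<alpha> powr s * (Z / (\<alpha> + b) powr s)" if "\<alpha> + b > 0" for b s Z
  proof -
    have "1 + b / \<alpha> = (\<alpha> + b) / \<alpha>"
      using \<alpha> by (simp add: field_simps)
    then show ?thesis
      using \<alpha> that by (simp add: powr_divide)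
  qed
  show ?thesis
  proof (cases "\<mu> = 0")
    case True
    define V where "V k = Gamma (r + real k + 1) / (\<alpha> + \<beta>) powr (r + real k + 1)
        + Gamma (r + real k + 1) / (\<alpha> - \<beta>) powr (r + real k + 1)" for k
    have "has_bochner_integral lborel (vg_component \<alpha> \<beta> \<mu> r k) (V k)" for k
      unfolding V_def True by (rule vg_component_integral_zero[OF assms(3,5)])
    then have "has_bochner_integral lborel (\<lambda>x. vg_pdf \<nu> \<alpha> \<beta> \<mu> x * \<bar>x\<bar> powr r)
      ((1 - \<beta>\<^sup>2 / \<alpha>\<^sup>2) ^ (m + 1) / (2 ^ (m + 1) * fact m * \<alpha> powr r) *
       (\<Sum>j=0..m. fact (m + j) / (fact (m - j) * fact j * 2 ^ j) * (\<alpha> powr (r + real (m - j) + 1) * V (m - j))))"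
      unfolding \<nu> using assms(3) by (intro vg_abs_moment) (simp_all flip: \<nu>)
    note E = expectation[OF this]
    have V: "\<alpha> powr (r + real (m - j) + 1) * V (m - j) =
        Gamma (r + real m - real j + 1) / (1 + \<beta> / \<alpha>) powr (r + real m - real j + 1)
        + Gamma (r + real m - real j + 1) / (1 - \<beta> / \<alpha>) powr (r + real m - real j + 1)" if "j \<in> {0..m}" for j
    proof -
      have eq: "r + real m - real j + 1 = r + real (m - j) + 1"
        using that by (simp add: of_nat_diff)
      have plus: "Z / (1 + \<beta> / \<alpha>) powr s = \<alpha> powr s * (Z / (\<alpha> + \<beta>) powr s)" for Z s
        using \<beta> by (intro scale) auto
      have minus: "Z / (1 - \<beta> / \<alpha>) powr s = \<alpha> powr s * (Z / (\<alpha> - \<beta>) powr s)" for Z s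
        using scale[of "- \<beta>" Z s] \<beta> by simp
      show ?thesis
        unfolding eq V_def plus minus by (rule distrib_left)
    qed
    show ?thesis
      using E True by (simp only: V simp_thms cong: sum.cong)
  next
    case False
    define V where "V k = exp (- \<alpha> * \<bar>\<mu>\<bar> - \<beta> * \<mu>) * Gamma (r + 1) / (\<alpha> + sgn \<mu> * \<beta>) powr (r + real k + 1)
        * tricomi_U (- real k) (- real k - r) (\<alpha> * \<bar>\<mu>\<bar> + \<beta> * \<mu>)
      + \<bar>\<mu>\<bar> powr (r + real k + 1) * Beta (r + 1) (real k + 1)
        * kummer_M (real k + 1) (r + real k + 2) (- \<alpha> * \<bar>\<mu>\<bar> - \<beta> * \<mu>)
      + \<bar>\<mu>\<bar> powr (r + real k + 1) * fact k * tricomi_U (real k + 1) (r + real k + 2) (\<alpha> * \<bar>\<mu>\<bar> - \<beta> * \<mu>)" for k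
    have "has_bochner_integral lborel (vg_component \<alpha> \<beta> \<mu> r k) (V k)" for k
      unfolding V_def by (rule vg_component_integral[OF assms(3) False assms(5)])
    then have "has_bochner_integral lborel (\<lambda>x. vg_pdf \<nu> \<alpha> \<beta> \<mu> x * \<bar>x\<bar> powr r)
      ((1 - \<beta>\<^sup>2 / \<alpha>\<^sup>2) ^ (m + 1) / (2 ^ (m + 1) * fact m * \<alpha> powr r) *
       (\<Sum>j=0..m. fact (m + j) / (fact (m - j) * fact j * 2 ^ j) * (\<alpha> powr (r + real (m - j) + 1) * V (m - j))))"
      unfolding \<nu> using assms(3) by (intro vg_abs_moment) (simp_all flip: \<nu>)
    note E = expectation[OF this]
    have V: "\<alpha> powr (r + real (m - j) + 1) * V (m - j) =
        exp (- \<alpha> * \<bar>\<mu>\<bar> - \<beta> * \<mu>) * Gamma (r + 1)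
              / (1 + sgn \<mu> * \<beta> / \<alpha>) powr (r + real m - real j + 1)
              * tricomi_U (real j - real m) (real j - real m - r) (\<alpha> * \<bar>\<mu>\<bar> + \<beta> * \<mu>)
           + (\<alpha> * \<bar>\<mu>\<bar>) powr (r + real m - real j + 1) * Beta (r + 1) (real m - real j + 1)
              * kummer_M (real m - real j + 1) (r + real m - real j + 2) (- \<alpha> * \<bar>\<mu>\<bar> - \<beta> * \<mu>)
           + (\<alpha> * \<bar>\<mu>\<bar>) powr (r + real m - real j + 1) * fact (m - j)
              * tricomi_U (real m - real j + 1) (r + real m - real j + 2) (\<alpha> * \<bar>\<mu>\<bar> - \<beta> * \<mu>)" if "j \<in> {0..m}" for j
    proof -
      define k where "k = m - j"
      have eqs: "r + real m - real j + 1 = r + real k + 1" "r + real m - real j + 2 = r + real k + 2"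
          "real m - real j + 1 = real k + 1" "real j - real m = - real k"
        using that by (simp_all add: k_def of_nat_diff)
      have "\<alpha> + sgn \<mu> * \<beta> > 0"
        using \<beta> by (simp add: sgn_if)
      note sc = scale[OF this]
      have pm: "(\<alpha> * \<bar>\<mu>\<bar>) powr s = \<alpha> powr s * \<bar>\<mu>\<bar> powr s" for s
        using \<alpha> by (simp add: powr_mult)
      show ?thesis
        unfolding eqs k_def[symmetric] V_def sc pm by (simp only: distrib_left mult.assoc)
    qed
    show ?thesis
      using E False by (simp only: V simp_thms cong: sum.cong)
  qed
qed

end
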